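(* Let $q$ be an odd prime power, let $n$ be a nonnegative integer, and fix some $T\in\operatorname{Sym}_n^\times$. Further, fix $d\in\mathbb F_q^\times$ and $t\in\mathbb F_q$. (a) Suppose that $n=2m+1$ is odd. Then the number $N(d,t)$ of $A\in\operatorname{Sym}_{2m+1}^\times$ such that $\det A=d$ and $\operatorname{tr}AT=t$ is $$\frac{q^{m^2+m}}{q(q-1)}\Bigg(\prod_{k=0}^m\left(q^{2k+1}-1\right)-(q-1)^{m+1}\Bigg)$$ $$+\,q^{m^2+m}\,\#\left\{(y_0,\ldots,y_m)\in\mathbb F_q^{m+1}:y_0+\cdots+y_m=t,\ \frac{y_0(y_1\cdots y_m)^2}{4^m\det T}=d\right\}.$$ (b) Suppose that $n=2m$ is even. Let $\chi\colon\mathbb F_q^\times\to\mathbb C^\times$ denote the nontrivial quadratic character. Then the number $N(d,t)$ of $A\in\operatorname{Sym}_{2m}^\times$ such that $\det A=d$ and $\operatorname{tr}AT=t$ is $$\frac{q^{m^2}}{q(q-1)}\Bigg(\left(q^m+\chi(-1)^m\chi(d)\right)\prod_{k=0}^{m-1}\left(q^{2k+1}-1\right)-\chi(-1)^m\left(\chi(d)+\chi(\det T)\right)(q-1)^m\Bigg)$$ $$+\,\chi((-1)^m\det T)\,q^{m^2}\,\#\left\{(y_1,\ldots,y_m)\in\mathbb F_q^m:y_1+\cdots+y_m=t,\ \frac{(y_1\cdots y_m)^2}{4^m\det T}=d\right\}.$$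
   Context: $\operatorname{Sym}_n^\times$ is the set of invertible symmetric $n\times n$ matrices over $\mathbb F_q$. *)

theory Defs
  imports
    "Jordan_Normal_Form.Determinant"
    "HOL-Number_Theory.Prime_Powers"
    "HOL-Library.FuncSet"
    "HOL-Library.Cardinality"
    Complex_Main
begin

definition mat_trace :: "'a::comm_monoid_add mat \<Rightarrow> 'a" where
  "mat_trace A = (\<Sum>i<dim_row A. A $$ (i, i))"

(* The size n is a natural number, so n = 0 is allowed; the unique 0 x 0 matrix
   is symmetric and invertible, with determinant 1 and trace 0. *)
definition invertible_sym_mats :: "nat \<Rightarrow> 'a::field mat set" where
  "invertible_sym_mats n = {A \<in> carrier_mat n n. transpose_mat A = A \<and> invertible_mat A}"

(* A nontrivial group homomorphism from the nonzero elements of the field to the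
   nonzero complex numbers whose square is trivial; nothing is said about chi 0. *)
definition nontrivial_quadratic_character :: "('a::field \<Rightarrow> complex) \<Rightarrow> bool" where
  "nontrivial_quadratic_character \<chi> \<longleftrightarrow>
     (\<forall>x. x \<noteq> 0 \<longrightarrow> \<chi> x \<noteq> 0) \<and>
     (\<forall>x y. x \<noteq> 0 \<longrightarrow> y \<noteq> 0 \<longrightarrow> \<chi> (x * y) = \<chi> x * \<chi> y) \<and>
     (\<forall>x. x \<noteq> 0 \<longrightarrow> (\<chi> x)\<^sup>2 = 1) \<and>
     (\<exists>x. x \<noteq> 0 \<and> \<chi> x \<noteq> 1)"

end

theory Submission
  imports Defs
begin

text \<open>
  Write \<open>q\<close> for the order of the field, \<open>\<eta>\<close> for its quadratic character and \<open>M(d)\<close> for the number of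
  invertible symmetric matrices of determinant \<open>d\<close>. If the trace against \<open>T\<close> were equidistributed
  on those matrices, the number of them with trace \<open>t\<close> would be \<open>M(d) / q\<close>. The proof is about the
  deviation from this mean, \<open>E\<^sub>T(d, t)\<close>, which obeys a linear recursion in the size of \<open>T\<close>.

  Both sides only depend on \<open>T\<close> up to congruence, with a compensating square factor in \<open>d\<close>. In odd
  characteristic a symmetric matrix is congruent to a diagonal one, so \<open>T\<close> may be split as
  \<open>t\<^sub>1 \<oplus> T'\<close>. The matrices \<open>A\<close> with corner entry \<open>a \<noteq> 0\<close> are parametrised by \<open>a\<close>, the rest \<open>b\<close> of the
  first row, and the Schur complement \<open>S\<close>, with \<open>det A = a det S\<close> and
  \<open>tr (A T) = a t\<^sub>1 + tr (S T') + Q(b) / a\<close>, where \<open>Q\<close> is the quadratic form of \<open>T'\<close>. On the matrices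
  with corner entry \<open>0\<close> the trace is equidistributed: adding multiples of the first row and column
  to the others keeps the determinant and the first row, and shifts the trace by any desired
  amount. They do not contribute to the deviation, and therefore
  \<open>E\<^sub>T(d, t) = \<Sum>\<^sub>a \<Sum>\<^sub>b E\<^sub>T\<^sub>'(d / a, t - a t\<^sub>1 - Q(b) / a)\<close>, with \<open>a \<noteq> 0\<close>; this is \<open>trace_dev_border\<close>.

  The sum over \<open>b\<close> only involves the representation numbers of \<open>Q\<close> (\<open>quad_count_eq\<close>). Up to a constant,
  which is killed because \<open>E\<^sub>T\<^sub>'(d, -)\<close> has sum \<open>0\<close>, they are a multiple of the indicator of \<open>0\<close> in even
  dimension and a multiple of \<open>\<eta>\<close> in odd dimension. When \<open>T'\<close> has even size, the recursion therefore
  only sums over \<open>y\<^sub>0 = a t\<^sub>1\<close>, the new variable of the tuples (\<open>dev_formula_border_even\<close>). When \<open>T'\<close> has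
  odd size, the recursion produces the Jacobi-type sum of \<open>\<eta>(x\<^sup>2 - u x + c)\<close> over \<open>x \<noteq> 0\<close>, which is
  \<open>q [u\<^sup>2 = 4 c] - 1 - \<eta>(c)\<close>: the discriminant condition turns \<open>y\<^sub>0\<close> into one more variable which
  occurs squared, and it is the source of the powers of \<open>4\<close> (\<open>dev_formula_border_odd\<close>).

  Finally \<open>M(d)\<close> is found by counting in two ways the pairs of a matrix \<open>A\<close> of determinant \<open>d\<close> and a
  vector which is not isotropic for \<open>A\<close> (\<open>sym_count_recursion\<close>): for a given \<open>A\<close> this is again a
  representation number, and for a given vector one may move it to the first unit vector.
\<close>

section \<open>The quadratic character of a finite field of odd order\<close>

text \<open>The value \<open>0\<close> at \<open>0\<close> makes the character multiplicative on the whole field and lets character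
  sums range over all field elements.\<close>

definition quad_char :: "'a::field \<Rightarrow> real" where
  "quad_char x = (if x = 0 then 0 else if \<exists>y. x = y\<^sup>2 then 1 else - 1)"

lemma quad_char_0 [simp]: "quad_char 0 = 0"
  and quad_char_1 [simp]: "quad_char 1 = 1"
  by (auto simp: quad_char_def intro: exI[of _ 1])

lemma quad_char_power2 [simp]: "x \<noteq> 0 \<Longrightarrow> quad_char (x\<^sup>2) = 1"
  by (auto simp: quad_char_def)

lemma quad_char_cases: "x \<noteq> 0 \<Longrightarrow> quad_char x = 1 \<or> quad_char x = - 1"
  by (auto simp: quad_char_def)

lemma quad_char_eq_1E:
  assumes "quad_char x = 1"
  obtains y where "y \<noteq> 0" "x = y\<^sup>2"
  using assms by (auto simp: quad_char_def split: if_splits)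

text \<open>Translation by \<open>1\<close> permutes the field, so the sum of all elements shows that \<open>q\<close> vanishes in the field.\<close>

lemma two_neq_0_if_odd_card:
  assumes "odd CARD('a::{field,finite})"
  shows "(2::'a) \<noteq> 0"
proof
  assume two: "(2::'a) = 0"
  have "(\<Sum>x\<in>UNIV. x + 1) = (\<Sum>x\<in>UNIV. x::'a)"
    by (rule sum.reindex_bij_witness[of _ "\<lambda>x. x - 1" "\<lambda>x. x + 1"]) auto
  then have *: "of_nat CARD('a) = (0::'a)"
    by (simp add: sum.distrib)
  from assms obtain k where "CARD('a) = 2 * k + 1" by (rule oddE)
  with * two show False by simp
qed

lemma one_less_card_field: "1 < real CARD('a::{field,finite})"
  using card_mono[of "UNIV :: 'a set" "{0, 1}"] by simp

lemma mult_sum_of_bool_eq: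
  fixes f :: "'b \<Rightarrow> real"
  assumes "finite A"
  shows "(\<Sum>x\<in>A. f x * of_bool (x = a)) = (if a \<in> A then f a else 0)"
    and "(\<Sum>x\<in>A. of_bool (x = a) * f x) = (if a \<in> A then f a else 0)"
proof -
  show "(\<Sum>x\<in>A. f x * of_bool (x = a)) = (if a \<in> A then f a else 0)"
    using assms by (subst sum.delta'[symmetric]) (auto intro!: sum.cong)
  then show "(\<Sum>x\<in>A. of_bool (x = a) * f x) = (if a \<in> A then f a else 0)"
    by (simp add: mult.commute)
qed

lemma real_card_eq_sum: 
  assumes "finite A"
  shows "real (card {x\<in>A. P x}) = (\<Sum>x\<in>A. of_bool (P x))"
proof -
  have "(\<Sum>x\<in>A. of_bool (P x)) = (\<Sum>x\<in>{x\<in>A. P x}. 1::real)"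
    using assms by (intro sum.mono_neutral_cong_right) auto
  then show ?thesis by simp
qed

context
  assumes two: "(2::'a::{field,finite}) \<noteq> 0"
begin

lemma card_square_roots: "real (card {x. x\<^sup>2 = (s::'a)}) = 1 + quad_char s"
proof (cases "s = 0 \<or> (\<forall>y. s \<noteq> y\<^sup>2)")
  case True
  show ?thesis
  proof (cases "s = 0")
    case False
    with True have "{x. x\<^sup>2 = s} = {}" by auto
    with True False show ?thesis by (auto simp: quad_char_def)
  qed auto
next
  case False
  then obtain y where s: "s = y\<^sup>2" and y: "y \<noteq> 0" by auto
  have "y \<noteq> - y"
  proof
    assume "y = - y"
    then have "2 * y = 0" by (metis add.right_inverse mult_2)
    with y two show False by simp
  qed
  moreover have "{x. x\<^sup>2 = s} = {y, - y}" by (auto simp: s power2_eq_iff)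
  ultimately show ?thesis using y by (simp add: s)
qed

text \<open>Every \<open>s\<close> is the square of exactly \<open>1 + quad_char s\<close> elements.\<close>

lemma sum_over_squares:
  "(\<Sum>x\<in>UNIV. f ((x::'a)\<^sup>2)) = (\<Sum>s\<in>UNIV. (1 + quad_char s) * f s)"
proof -
  have card: "1 + quad_char s = (\<Sum>x\<in>UNIV. of_bool (s = (x::'a)\<^sup>2))" for s
    using card_square_roots[of s] real_card_eq_sum[of "UNIV::'a set" "\<lambda>x. s = x\<^sup>2"]
    by (simp add: eq_commute[of s])
  have "(\<Sum>s\<in>UNIV. (1 + quad_char s) * f s) = (\<Sum>s\<in>UNIV. \<Sum>x\<in>UNIV. of_bool (s = (x::'a)\<^sup>2) * f s)"
    by (simp only: card sum_distrib_right)
  also have "\<dots> = (\<Sum>x\<in>UNIV. \<Sum>s\<in>UNIV. of_bool (s = (x::'a)\<^sup>2) * f s)"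
    by (rule sum.swap)
  also have "\<dots> = (\<Sum>x\<in>UNIV. f ((x::'a)\<^sup>2))"
    by (simp only: mult_sum_of_bool_eq(2)[OF finite] UNIV_I if_True)
  finally show ?thesis ..
qed

lemma sum_quad_char: "(\<Sum>s\<in>UNIV. quad_char (s::'a)) = 0"
  using sum_over_squares[of "\<lambda>_. 1"] by (simp add: sum.distrib)

text \<open>Only the product of two nonsquares needs an argument. For a nonsquare \<open>a\<close> the function
  \<open>quad_char s + quad_char (a s)\<close> is nowhere positive: it vanishes at \<open>0\<close> and at the nonzero squares, whose multiples by
  \<open>a\<close> are nonsquares. As its sum over the field is \<open>0\<close>, it vanishes identically.\<close>

lemma quad_char_mult: "quad_char (a * b :: 'a) = quad_char a * quad_char b"
proof -
  have square_mult: "quad_char (a * b) = quad_char b" if "a = y\<^sup>2" "a \<noteq> 0" for a b y :: 'a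
  proof -
    have "(\<exists>z. a * b = z\<^sup>2) \<longleftrightarrow> (\<exists>z. b = z\<^sup>2)"
    proof
      assume "\<exists>z. a * b = z\<^sup>2"
      then obtain z where "a * b = z\<^sup>2" ..
      with that have "b = (z / y)\<^sup>2" by (simp add: power_divide field_simps)
      then show "\<exists>z. b = z\<^sup>2" ..
    next
      assume "\<exists>z. b = z\<^sup>2"
      then show "\<exists>z. a * b = z\<^sup>2" using that by (metis power_mult_distrib)
    qed
    with that show ?thesis by (auto simp: quad_char_def)
  qed
  have nonsquare_mult: "quad_char (a * b) = - quad_char b" if a: "quad_char a = - 1" for a b :: 'a
  proof -
    have a0: "a \<noteq> 0" using a by auto
    have nonpos: "quad_char s + quad_char (a * s) \<le> 0" for s
    proof (cases "quad_char s = 1")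
      case True
      then obtain y where "s = y\<^sup>2" "s \<noteq> 0" by (auto simp: quad_char_def split: if_splits)
      from square_mult[OF this, of a] have "quad_char (a * s) = - 1" using a by (simp add: mult.commute)
      then show ?thesis using True by simp
    next
      case False
      then show ?thesis
        using quad_char_cases[of s] quad_char_cases[of "a * s"] a0 by (cases "s = 0") auto
    qed
    have "(\<Sum>s\<in>UNIV. quad_char (a * s)) = (\<Sum>s\<in>UNIV. quad_char (s::'a))"
      by (rule sum.reindex_bij_witness[of _ "\<lambda>s. s / a" "\<lambda>s. a * s"]) (auto simp: a0)
    then have "(\<Sum>s\<in>UNIV. - (quad_char s + quad_char (a * s))) = 0"
      by (simp add: sum.distrib sum_negf sum_quad_char sum_subtractf)
    then have "\<forall>s\<in>UNIV. - (quad_char s + quad_char (a * s)) = 0"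
      by (subst (asm) sum_nonneg_eq_0_iff) (use nonpos in \<open>simp_all add: neg_0_le_iff_le del: minus_add_distrib\<close>)
    then have "quad_char b + quad_char (a * b) = 0" by (metis UNIV_I neg_equal_0_iff_equal)
    then show ?thesis by simp
  qed
  show ?thesis
  proof (cases "a = 0")
    case False
    then consider "quad_char a = 1" | "quad_char a = - 1"
      using quad_char_cases by blast
    then show ?thesis
    proof cases
      case 1
      then show ?thesis using square_mult[OF _ False] by (metis quad_char_eq_1E mult_1)
    qed (simp add: nonsquare_mult)
  qed simp
qed

lemma quad_char_mult_self: "(a::'a) \<noteq> 0 \<Longrightarrow> quad_char a * quad_char a = 1"
  using quad_char_cases[of a] by auto

lemma quad_char_square_mult: "y \<noteq> (0::'a) \<Longrightarrow> quad_char (y\<^sup>2 * a) = quad_char a"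
  by (simp add: quad_char_mult)

lemma quad_char_divide: "quad_char (a / b :: 'a) = quad_char a * quad_char b"
proof (cases "b = 0")
  case False
  then have "a / b = a * b * (1 / b)\<^sup>2" by (simp add: power2_eq_square field_simps)
  then show ?thesis using False by (simp only: quad_char_mult) (simp add: quad_char_power2)
qed simp

lemma quad_char_power: "quad_char (a ^ k :: 'a) = quad_char a ^ k"
  by (induction k) (auto simp: quad_char_mult)

text \<open>Counting square roots turns the sum into that of \<open>quad_char (s (s - D))\<close>. For \<open>D \<noteq> 0\<close> and \<open>s \<noteq> 0\<close>
  this is \<open>quad_char (1 - D / s)\<close>, and \<open>1 - D / s\<close> runs through all elements but \<open>1\<close>.\<close>

lemma sum_quad_char_square_minus:
  "(\<Sum>x\<in>UNIV. quad_char (x\<^sup>2 - D :: 'a)) = (if D = 0 then real CARD('a) else 0) - 1"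
proof (cases "D = 0")
  case True
  have "(\<Sum>x\<in>UNIV. quad_char ((x::'a)\<^sup>2)) = (\<Sum>x\<in>UNIV - {0::'a}. 1)"
    by (intro sum.mono_neutral_cong_right) auto
  also have "\<dots> = real CARD('a) - 1" by (simp add: card_Diff_singleton of_nat_diff)
  finally show ?thesis using True by simp
next
  case False
  have "(\<Sum>x\<in>UNIV. quad_char ((x::'a)\<^sup>2 - D)) = (\<Sum>s\<in>UNIV. quad_char (s - D)) + (\<Sum>s\<in>UNIV. quad_char (s * (s - D)))"
    by (subst sum_over_squares) (simp add: distrib_right sum.distrib quad_char_mult)
  also have "(\<Sum>s\<in>UNIV. quad_char (s - D)) = (\<Sum>s\<in>UNIV. quad_char (s::'a))"
    by (rule sum.reindex_bij_witness[of _ "\<lambda>s. s + D" "\<lambda>s. s - D"]) auto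
  also have "\<dots> = 0" by (rule sum_quad_char)
  also have "(\<Sum>s\<in>UNIV. quad_char (s * (s - D))) = (\<Sum>s\<in>UNIV - {0}. quad_char (s * (s - D)))"
    by (rule sum.mono_neutral_right) auto
  also have "\<dots> = (\<Sum>w\<in>UNIV - {1}. quad_char (w::'a))"
  proof (rule sum.reindex_bij_witness[of _ "\<lambda>w. D / (1 - w)" "\<lambda>s. 1 - D / s"])
    fix s :: 'a assume "s \<in> UNIV - {0}"
    then have s: "s \<noteq> 0" by simp
    have "s * (s - D) = s\<^sup>2 * (1 - D / s)" using s by (simp add: power2_eq_square field_simps)
    then show "quad_char (1 - D / s) = quad_char (s * (s - D))"
      using s by (simp add: quad_char_square_mult)
  qed (use False in auto)
  also have "\<dots> = - 1" using sum_quad_char by (simp add: sum_diff1)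
  finally show ?thesis using False by simp
qed

text \<open>This follows by completing the square. The point \<open>x = 0\<close> is left out because, in the application,
  \<open>x\<close> is a nonzero corner entry; it accounts for the term \<open>quad_char c\<close>.\<close>

lemma sum_quad_char_quadratic:
  "(\<Sum>x\<in>UNIV - {0}. quad_char (x\<^sup>2 - u * x + c :: 'a)) =
     (if u\<^sup>2 = 4 * c then real CARD('a) else 0) - 1 - quad_char c"
proof -
  define D where "D = (u / 2)\<^sup>2 - c"
  \<comment> \<open>Multiplication by 4 compares the two forms of the discriminant, so it has to be injective.\<close>
  have four: "(4::'a) \<noteq> 0" proof -
    have "(4::'a) = 2 * 2" by simp
    then show ?thesis using two by (metis mult_eq_0_iff)
  qed
  have D_iff: "D = 0 \<longleftrightarrow> u\<^sup>2 = 4 * c"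
  proof -
    have "4 * D = u\<^sup>2 - 4 * c" using four by (simp add: D_def power_divide right_diff_distrib)
    then show ?thesis using four by (metis eq_iff_diff_eq_0 mult_eq_0_iff)
  qed
  have complete: "(x + u / 2)\<^sup>2 - u * (x + u / 2) + c = x\<^sup>2 - D" for x
  proof -
    have "(x + h)\<^sup>2 - (2 * h) * (x + h) + c = x\<^sup>2 - (h\<^sup>2 - c)" for h
      by (simp add: power2_eq_square algebra_simps)
    from this[of "u / 2"] show ?thesis using two by (simp add: D_def)
  qed
  have "(\<Sum>x\<in>UNIV. quad_char (x\<^sup>2 - u * x + c)) = (\<Sum>x\<in>UNIV. quad_char (x\<^sup>2 - D))"
  proof (rule sum.reindex_bij_witness[of _ "\<lambda>x. x + u / 2" "\<lambda>x. x - u / 2"])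
    fix x show "quad_char ((x - u / 2)\<^sup>2 - D) = quad_char (x\<^sup>2 - u * x + c)"
      using complete[of "x - u / 2"] by simp
  qed auto
  also have "(\<Sum>x\<in>UNIV. quad_char (x\<^sup>2 - D)) = (if u\<^sup>2 = 4 * c then real CARD('a) else 0) - 1"
    by (simp add: sum_quad_char_square_minus D_iff)
  finally show ?thesis by (simp add: sum_diff1)
qed

text \<open>An abstract quadratic character is \<open>1\<close> on squares. Being nontrivial, it is \<open>- 1\<close> at some nonsquare
  \<open>z\<close>, and then at every nonsquare \<open>x\<close>, as \<open>x z\<close> is a square.\<close>

lemma nontrivial_quadratic_character_eq:
  assumes "nontrivial_quadratic_character \<chi>" and "(x::'a) \<noteq> 0"
  shows "\<chi> x = complex_of_real (quad_char x)"
proof -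
  have mult: "\<chi> (x * y) = \<chi> x * \<chi> y" if "x \<noteq> 0" "y \<noteq> 0" for x y
    using assms that by (auto simp: nontrivial_quadratic_character_def)
  have sq: "(\<chi> x)\<^sup>2 = 1" if "x \<noteq> 0" for x
    using assms that by (auto simp: nontrivial_quadratic_character_def)
  have square: "\<chi> x = 1" if "quad_char x = 1" for x
  proof -
    from that obtain y where "x = y\<^sup>2" "y \<noteq> 0" by (auto simp: quad_char_def split: if_splits)
    then show ?thesis using mult[of y y] sq[of y] by (simp add: power2_eq_square)
  qed
  obtain z where z: "z \<noteq> 0" "\<chi> z \<noteq> 1"
    using assms by (auto simp: nontrivial_quadratic_character_def)
  have z': "quad_char z = - 1" "\<chi> z = - 1"
    using square[of z] quad_char_cases[of z] sq[of z] z by (auto simp: power2_eq_1_iff)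
  show ?thesis
  proof (cases "quad_char x = 1")
    case False
    then have x: "quad_char x = - 1" using quad_char_cases[OF assms(2)] by auto
    then have "\<chi> (x * z) = 1" by (intro square) (simp add: quad_char_mult z')
    then have "\<chi> x = - 1" using mult[OF assms(2) z(1)] z' by (simp add: minus_equation_iff[of "\<chi> x"])
    with x show ?thesis by simp
  qed (simp add: square)
qed

end

section \<open>Symmetric matrices, congruence and Schur complements\<close>

definition quad_form :: "'a::comm_ring_1 mat \<Rightarrow> 'a vec \<Rightarrow> 'a" where
  "quad_form T v = v \<bullet> (T *\<^sub>v v)"

text \<open>A border is a single constant, rather than a block matrix with blocks of sizes \<open>1 \<times> 1\<close>, \<open>1 \<times> n\<close>,
  \<open>n \<times> 1\<close> and \<open>n \<times> n\<close>, so that the first row is kept as a vector.\<close>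

definition border :: "'a \<Rightarrow> 'a vec \<Rightarrow> 'a mat \<Rightarrow> 'a mat" where
  "border a b C = mat (Suc (dim_vec b)) (Suc (dim_vec b)) (\<lambda>(i, j).
     if i = 0 then (if j = 0 then a else b $ (j - 1))
     else (if j = 0 then b $ (i - 1) else C $$ (i - 1, j - 1)))"

text \<open>Multiplication by this matrix from the left adds \<open>c $ i\<close> times row \<open>0\<close> to row \<open>i + 1\<close>.\<close>

definition shear :: "'a::zero_neq_one vec \<Rightarrow> 'a mat" where
  "shear c = mat (Suc (dim_vec c)) (Suc (dim_vec c)) (\<lambda>(i, j).
     if i = j then 1 else if j = 0 then c $ (i - 1) else 0)"

definition add_outer :: "'a::comm_ring_1 \<Rightarrow> 'a vec \<Rightarrow> 'a mat \<Rightarrow> 'a mat" where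
  "add_outer k b S = mat (dim_vec b) (dim_vec b) (\<lambda>(i, j). S $$ (i, j) + k * b $ i * b $ j)"

lemma invertible_sym_mats_iff:
  "A \<in> invertible_sym_mats n \<longleftrightarrow> A \<in> carrier_mat n n \<and> transpose_mat A = A \<and> det A \<noteq> 0"
proof -
  have "invertible_mat A \<longleftrightarrow> det A \<noteq> 0" if A: "A \<in> carrier_mat n n"
  proof
    assume "invertible_mat A"
    then obtain B where AB: "A * B = 1\<^sub>m n" and BA: "B * A = 1\<^sub>m (dim_row B)"
      using A by (auto simp: invertible_mat_def inverts_mat_def)
    have "dim_row B = n" "dim_col B = n"
      using arg_cong[OF AB, of dim_col] arg_cong[OF BA, of dim_col] A by auto
    then have "det A * det B = 1" using AB A det_mult[of A n B] by (metis carrier_matI det_one)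
    then show "det A \<noteq> 0" by auto
  next
    assume "det A \<noteq> 0"
    from det_non_zero_imp_unit[OF A this, of "()"] A show "invertible_mat A"
      by (auto simp: Units_def ring_mat_def invertible_mat_def inverts_mat_def)
  qed
  then show ?thesis by (auto simp: invertible_sym_mats_def)
qed

lemma invertible_sym_matsD:
  assumes "A \<in> invertible_sym_mats n"
  shows "A \<in> carrier_mat n n" "transpose_mat A = A" "det A \<noteq> 0" "dim_row A = n" "dim_col A = n"
  using assms by (auto simp: invertible_sym_mats_iff)

lemma invertible_sym_mats_0: "(invertible_sym_mats 0 :: 'a::field mat set) = {1\<^sub>m 0}"
proof -
  have "A = 1\<^sub>m 0" if "A \<in> invertible_sym_mats 0" for A :: "'a mat"
    using invertible_sym_matsD(4,5)[OF that] by (intro eq_matI) auto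
  moreover have "1\<^sub>m 0 \<in> (invertible_sym_mats 0 :: 'a mat set)" by (simp add: invertible_sym_mats_iff)
  ultimately show ?thesis by blast
qed

lemma finite_carrier_vec [simp]: "finite (carrier_vec n :: 'a::finite vec set)"
proof (rule finite_subset)
  show "carrier_vec n \<subseteq> vec n ` ({..<n} \<rightarrow>\<^sub>E (UNIV :: 'a set))"
  proof
    fix v :: "'a vec" assume "v \<in> carrier_vec n"
    then have "v = vec n (restrict (($) v) {..<n})" by auto
    then show "v \<in> vec n ` ({..<n} \<rightarrow>\<^sub>E UNIV)" by (metis PiE_restrict Pi_UNIV UNIV_I imageI restrict_PiE_iff)
  qed
qed (simp add: finite_PiE)

lemma finite_invertible_sym_mats [simp]: "finite (invertible_sym_mats n :: 'a::{field,finite} mat set)"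
proof (rule finite_subset)
  let ?I = "{..<n} \<times> {..<n}"
  show "invertible_sym_mats n \<subseteq> mat n n ` (?I \<rightarrow>\<^sub>E (UNIV :: 'a set))"
  proof
    fix A :: "'a mat" assume "A \<in> invertible_sym_mats n"
    then have "A = mat n n (restrict (($$) A) ?I)" 
      using invertible_sym_matsD[of A n] by (intro eq_matI) auto
    then show "A \<in> mat n n ` (?I \<rightarrow>\<^sub>E UNIV)" by (metis UNIV_I imageI restrict_PiE_iff)
  qed
qed (simp add: finite_PiE)

lemma bij_betw_vCons:
  "bij_betw (\<lambda>(x, v). vCons x v) (UNIV \<times> carrier_vec n) (carrier_vec (Suc n))"
proof (rule bij_betw_byWitness[where f' = "\<lambda>v. (v $ 0, vec n (\<lambda>i. v $ Suc i))"])
  show "\<forall>v\<in>carrier_vec (Suc n). (\<lambda>(x, v). vCons x v) (v $ 0, vec n (\<lambda>i. v $ Suc i)) = v"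
    by (auto intro!: eq_vecI simp: vec_index_vCons)
qed (auto intro!: eq_vecI)

lemma sum_carrier_vec_Suc:
  "(\<Sum>v\<in>carrier_vec (Suc n). f v) = (\<Sum>x\<in>UNIV. \<Sum>v\<in>carrier_vec n. f (vCons x v))"
  using sum.reindex_bij_betw[OF bij_betw_vCons, of f n]
  by (simp add: sum.cartesian_product case_prod_unfold)

lemma carrier_vec_0: "carrier_vec 0 = {vNil}"
  by auto

lemma card_carrier_vec: "card (carrier_vec n :: 'a::finite vec set) = CARD('a) ^ n"
proof (induction n)
  case (Suc n)
  have "card (carrier_vec (Suc n) :: 'a vec set) = (\<Sum>v\<in>(carrier_vec (Suc n) :: 'a vec set). 1)" by simp
  also have "\<dots> = CARD('a) ^ Suc n"
    by (subst sum_carrier_vec_Suc) (simp add: Suc)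
  finally show ?case .
qed (simp add: carrier_vec_0)

lemma mat_trace_mult:
  assumes "A \<in> carrier_mat n n" "B \<in> carrier_mat n n"
  shows "mat_trace (A * B) = (\<Sum>i<n. \<Sum>j<n. A $$ (i, j) * B $$ (j, i))"
  using assms by (auto simp: mat_trace_def scalar_prod_def lessThan_atLeast0 intro!: sum.cong)

lemma mat_trace_commute:
  fixes A :: "'a::comm_ring_1 mat"
  assumes "A \<in> carrier_mat n n" "B \<in> carrier_mat n n"
  shows "mat_trace (A * B) = mat_trace (B * A)"
  by (simp add: mat_trace_mult[OF assms] mat_trace_mult[OF assms(2,1)] mult.commute)
    (rule sum.swap)

lemma quad_form_sum:
  assumes "T \<in> carrier_mat n n" "v \<in> carrier_vec n"
  shows "quad_form T v = (\<Sum>i<n. \<Sum>j<n. T $$ (i, j) * v $ i * v $ j)"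
  using assms
  by (auto simp: quad_form_def scalar_prod_def lessThan_atLeast0 sum_distrib_left mult_ac intro!: sum.cong)

lemma quad_form_congruence:
  assumes "T \<in> carrier_mat n n" "g \<in> carrier_mat n n" "v \<in> carrier_vec n"
  shows "quad_form (transpose_mat g * T * g) v = quad_form T (g *\<^sub>v v)"
proof -
  have "quad_form (transpose_mat g * T * g) v = v \<bullet> (transpose_mat g *\<^sub>v (T *\<^sub>v (g *\<^sub>v v)))"
    using assms by (simp add: quad_form_def assoc_mult_mat_vec[of _ n n _ n])
  also have "\<dots> = (g *\<^sub>v v) \<bullet> (T *\<^sub>v (g *\<^sub>v v))"
    using transpose_vec_mult_scalar[of g n n v "T *\<^sub>v (g *\<^sub>v v)"] assms
      comm_scalar_prod[of v n] comm_scalar_prod[of "g *\<^sub>v v" n] by simp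
  finally show ?thesis by (simp add: quad_form_def)
qed

text \<open>Congruence moves the first column of \<open>g\<close> to the first unit vector: the values of the form of \<open>T\<close> at
  arbitrary vectors become corner entries.\<close>

lemma congruence_entry_0:
  assumes "T \<in> carrier_mat (Suc n) (Suc n)" "g \<in> carrier_mat (Suc n) (Suc n)"
  shows "(transpose_mat g * T * g) $$ (0, 0) = quad_form T (col g 0)"
proof -
  have "transpose_mat g * T * g = transpose_mat g * (T * g)"
    using assms by (intro assoc_mult_mat) auto
  moreover have "col (T * g) 0 = T *\<^sub>v col g 0"
    using assms by (intro col_mult2[of _ "Suc n" "Suc n" _ "Suc n"]) auto
  ultimately show ?thesis using assms by (simp add: quad_form_def del: col_mult2)
qed

lemma congruence_invertible_sym:
  fixes g :: "'a::field mat"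
  assumes "A \<in> invertible_sym_mats n" "g \<in> carrier_mat n n" "det g \<noteq> 0"
  shows "transpose_mat g * A * g \<in> invertible_sym_mats n"
    and "det (transpose_mat g * A * g) = (det g)\<^sup>2 * det A"
proof -
  note A = invertible_sym_matsD[OF assms(1)]
  show det: "det (transpose_mat g * A * g) = (det g)\<^sup>2 * det A"
    using A assms by (simp add: det_mult[of _ n] det_transpose[of _ n] power2_eq_square)
  have "transpose_mat (transpose_mat g * A * g) = transpose_mat g * A * g"
    using A assms by (simp add: transpose_mult[of _ n n _ n] assoc_mult_mat[of _ n n _ n _ n])
  with det show "transpose_mat g * A * g \<in> invertible_sym_mats n"
    using A assms by (simp add: invertible_sym_mats_iff)
qed

lemma inverse_mat_exists:
  fixes g :: "'a::field mat"
  assumes "g \<in> carrier_mat n n" "det g \<noteq> 0"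
  obtains h where "h \<in> carrier_mat n n" "g * h = 1\<^sub>m n" "h * g = 1\<^sub>m n" "det h \<noteq> 0"
proof -
  from det_non_zero_imp_unit[OF assms, of "()"]
  obtain h where h: "h \<in> carrier_mat n n" "g * h = 1\<^sub>m n" "h * g = 1\<^sub>m n"
    by (auto simp: Units_def ring_mat_def)
  moreover from h have "det g * det h = 1" using assms det_mult[of g n h] by simp
  then have "det h \<noteq> 0" by auto
  ultimately show ?thesis using that by blast
qed

lemma congruence_inverse:
  fixes g :: "'a::field mat"
  assumes "A \<in> carrier_mat n n" "g \<in> carrier_mat n n" "h \<in> carrier_mat n n" "g * h = 1\<^sub>m n"
  shows "transpose_mat h * (transpose_mat g * A * g) * h = A"
proof -
  have "transpose_mat h * (transpose_mat g * A * g) * h = transpose_mat h * (transpose_mat g * (A * (g * h)))"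
    using assms by (simp add: assoc_mult_mat[of _ n n _ n _ n])
  also have "\<dots> = (transpose_mat h * transpose_mat g) * A"
    using assms by (simp add: assoc_mult_mat[of _ n n _ n _ n])
  also have "transpose_mat h * transpose_mat g = transpose_mat (g * h)"
    using transpose_mult[OF assms(2,3)] by simp
  finally show ?thesis using assms by simp
qed

lemma bij_betw_congruence:
  fixes g :: "'a::field mat"
  assumes g: "g \<in> carrier_mat n n" "det g \<noteq> 0"
  shows "bij_betw (\<lambda>A. transpose_mat g * A * g) (invertible_sym_mats n) (invertible_sym_mats n)"
proof -
  obtain h where h: "h \<in> carrier_mat n n" "g * h = 1\<^sub>m n" "h * g = 1\<^sub>m n" "det h \<noteq> 0"
    by (rule inverse_mat_exists[OF g])
  show ?thesis
    by (rule bij_betw_byWitness[where f' = "\<lambda>A. transpose_mat h * A * h"])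
      (use g h in \<open>auto simp: congruence_invertible_sym congruence_inverse[of _ n] invertible_sym_matsD(1)\<close>)
qed

lemma bij_betw_mult_mat_vec:
  fixes g :: "'a::field mat"
  assumes g: "g \<in> carrier_mat n n" "det g \<noteq> 0"
  shows "bij_betw (\<lambda>v. g *\<^sub>v v) (carrier_vec n) (carrier_vec n)"
proof -
  obtain h where h: "h \<in> carrier_mat n n" "g * h = 1\<^sub>m n" "h * g = 1\<^sub>m n" "det h \<noteq> 0"
    by (rule inverse_mat_exists[OF g])
  show ?thesis
    by (rule bij_betw_byWitness[where f' = "\<lambda>v. h *\<^sub>v v"])
      (use g h in \<open>auto simp: assoc_mult_mat_vec[of _ n n _ n, symmetric]\<close>)
qed

lemma dim_border [simp]:
  "dim_row (border a b C) = Suc (dim_vec b)" "dim_col (border a b C) = Suc (dim_vec b)"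
  by (simp_all add: border_def)

lemma border_carrier [simp]: "b \<in> carrier_vec n \<Longrightarrow> border a b C \<in> carrier_mat (Suc n) (Suc n)"
  by auto

lemma index_border [simp]:
  "border a b C $$ (0, 0) = a"
  "j < dim_vec b \<Longrightarrow> border a b C $$ (0, Suc j) = b $ j"
  "i < dim_vec b \<Longrightarrow> border a b C $$ (Suc i, 0) = b $ i"
  "i < dim_vec b \<Longrightarrow> j < dim_vec b \<Longrightarrow> border a b C $$ (Suc i, Suc j) = C $$ (i, j)"
  by (simp_all add: border_def)

lemma eq_border_iff:
  assumes "A \<in> carrier_mat (Suc n) (Suc n)" "b \<in> carrier_vec n"
  shows "A = border a b C \<longleftrightarrow> A $$ (0, 0) = a \<and> (\<forall>j<n. A $$ (0, Suc j) = b $ j) \<and>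
    (\<forall>i<n. A $$ (Suc i, 0) = b $ i) \<and> (\<forall>i<n. \<forall>j<n. A $$ (Suc i, Suc j) = C $$ (i, j))" (is "_ \<longleftrightarrow> ?R")
proof
  assume R: ?R
  show "A = border a b C"
  proof (rule eq_matI)
    fix i j assume "i < dim_row (border a b C)" "j < dim_col (border a b C)"
    then show "A $$ (i, j) = border a b C $$ (i, j)"
      using R assms by (cases i; cases j) auto
  qed (use assms in auto)
qed (use assms in auto)

lemma transpose_border:
  assumes "b \<in> carrier_vec n" "C \<in> carrier_mat n n"
  shows "transpose_mat (border a b C) = border a b (transpose_mat C)"
  using assms by (subst eq_border_iff[of _ n]) auto

lemma border_inject:
  assumes "b \<in> carrier_vec n" "b' \<in> carrier_vec n" "C \<in> carrier_mat n n" "C' \<in> carrier_mat n n"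
  shows "border a b C = border a' b' C' \<longleftrightarrow> a = a' \<and> b = b' \<and> C = C'"
  using assms by (subst eq_border_iff[of _ n]) (auto intro!: eq_vecI eq_matI)

lemma sym_eq_border:
  assumes "A \<in> carrier_mat (Suc n) (Suc n)" "transpose_mat A = A"
  obtains b C where "b \<in> carrier_vec n" "C \<in> carrier_mat n n" "transpose_mat C = C"
    "A = border (A $$ (0, 0)) b C"
proof
  have sym: "A $$ (j, i) = A $$ (i, j)" if "i < Suc n" "j < Suc n" for i j
    using assms that by (metis carrier_matD index_transpose_mat(1))
  let ?b = "vec n (\<lambda>i. A $$ (0, Suc i))" and ?C = "mat n n (\<lambda>(i, j). A $$ (Suc i, Suc j))"
  show "transpose_mat ?C = ?C" by (intro eq_matI) (auto simp: sym)
  show "A = border (A $$ (0, 0)) ?b ?C"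
    using assms by (subst eq_border_iff[of _ n]) (auto intro: sym)
qed auto

lemma shear_carrier [simp]: "c \<in> carrier_vec n \<Longrightarrow> shear c \<in> carrier_mat (Suc n) (Suc n)"
  by (auto simp: shear_def)

lemma dim_shear [simp]: "dim_row (shear c) = Suc (dim_vec c)" "dim_col (shear c) = Suc (dim_vec c)"
  by (simp_all add: shear_def)

lemma det_shear [simp]: "det (shear (c :: 'a::idom vec)) = 1"
proof -
  have "det (shear c) = prod_list (diag_mat (shear c))"
    by (rule det_lower_triangular[of "Suc (dim_vec c)"]) (auto simp: shear_def)
  also have "\<dots> = (\<Prod>i<Suc (dim_vec c). 1)"
    by (auto simp: prod_list_diag_prod shear_def lessThan_atLeast0 intro!: prod.cong)
  finally show ?thesis by simp
qed

lemma shear_mult: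
  fixes c :: "'a::comm_ring_1 vec"
  assumes "c \<in> carrier_vec n" "M \<in> carrier_mat (Suc n) m"
  shows "shear c * M = mat (Suc n) m (\<lambda>(i, j). (if i = 0 then 0 else c $ (i - 1) * M $$ (0, j)) + M $$ (i, j))"
proof (rule eq_matI)
  fix i j assume ij: "i < dim_row (mat (Suc n) m (\<lambda>(i, j). (if i = 0 then 0 else c $ (i - 1) * M $$ (0, j)) + M $$ (i, j)))"
    "j < dim_col (mat (Suc n) m (\<lambda>(i, j). (if i = 0 then 0 else c $ (i - 1) * M $$ (0, j)) + M $$ (i, j)))"
  have "(shear c * M) $$ (i, j) = (\<Sum>k<Suc n. shear c $$ (i, k) * M $$ (k, j))"
    using ij assms by (simp add: scalar_prod_def lessThan_atLeast0 del: sum.op_ivl_Suc)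
  also have "\<dots> = (\<Sum>k<Suc n. (if k = 0 then if i = 0 then 0 else c $ (i - 1) * M $$ (0, j) else 0)
      + (if k = i then M $$ (i, j) else 0))"
    using ij assms by (intro sum.cong) (auto simp: shear_def)
  also have "\<dots> = (if i = 0 then 0 else c $ (i - 1) * M $$ (0, j)) + M $$ (i, j)"
    unfolding sum.distrib using ij by (simp add: sum.delta del: sum.lessThan_Suc)
  finally show "(shear c * M) $$ (i, j) = mat (Suc n) m (\<lambda>(i, j). (if i = 0 then 0 else c $ (i - 1) * M $$ (0, j)) + M $$ (i, j)) $$ (i, j)"
    using ij by simp
qed (use assms in auto)

text \<open>Both uses of the corner entry rest on this identity. If \<open>a \<noteq> 0\<close>, it eliminates the first row
  (Schur complement). If \<open>a = 0\<close>, it keeps the first row and changes the rest of the matrix by the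
  symmetric product of \<open>b\<close> and \<open>c\<close>.\<close>

lemma shear_congruence_border:
  fixes a :: "'a::comm_ring_1"
  assumes c: "c \<in> carrier_vec n" and b: "b \<in> carrier_vec n"
  shows "shear c * border a b C * transpose_mat (shear c) =
    border a (b + a \<cdot>\<^sub>v c) (mat n n (\<lambda>(i, j). C $$ (i, j) + c $ i * b $ j + b $ i * c $ j + a * c $ i * c $ j))"
proof -
  let ?X = "shear c * border a b C"
  have X: "?X \<in> carrier_mat (Suc n) (Suc n)"
    by (rule mult_carrier_mat[OF shear_carrier[OF c] border_carrier[OF b]])
  have "?X * transpose_mat (shear c) = transpose_mat (shear c * transpose_mat ?X)"
    using transpose_mult[OF shear_carrier[OF c], of "transpose_mat ?X" "Suc n"] X by simp
  also have "\<dots> = border a (b + a \<cdot>\<^sub>v c) (mat n n (\<lambda>(i, j). C $$ (i, j) + c $ i * b $ j + b $ i * c $ j + a * c $ i * c $ j))"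
    using b c X by (subst eq_border_iff[of _ n])
      (auto simp: shear_mult[of _ n _ "Suc n"] algebra_simps)
  finally show ?thesis .
qed

lemma add_outer_carrier [simp]: "b \<in> carrier_vec n \<Longrightarrow> add_outer k b S \<in> carrier_mat n n"
  by (auto simp: add_outer_def)

lemma border_add_outer:
  fixes a :: "'a::field"
  assumes a: "a \<noteq> 0" and b: "b \<in> carrier_vec n" 
  shows "border a b (add_outer (1 / a) b S) =
    shear ((1 / a) \<cdot>\<^sub>v b) * border a (0\<^sub>v n) S * transpose_mat (shear ((1 / a) \<cdot>\<^sub>v b))"
  using a b by (subst shear_congruence_border[of _ n], simp, simp, subst eq_border_iff[of _ n])
    (auto simp: add_outer_def)

lemma det_border_zero:
  fixes a :: "'a::idom"
  assumes "S \<in> carrier_mat n n"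
  shows "det (border a (0\<^sub>v n) S) = a * det S"
proof -
  have "border a (0\<^sub>v n) S = four_block_mat (mat 1 1 (\<lambda>_. a)) (0\<^sub>m 1 n) (0\<^sub>m n 1) S"
    using assms by (intro eq_matI) (auto simp: border_def)
  also have "det \<dots> = det (mat 1 1 (\<lambda>_. a)) * det S"
    using assms by (intro det_four_block_mat_lower_left_zero_col) auto
  also have "det (mat 1 1 (\<lambda>_. a)) = a" by (simp add: det_single)
  finally show ?thesis .
qed

lemma det_border_add_outer:
  fixes a :: "'a::field"
  assumes "a \<noteq> 0" "b \<in> carrier_vec n" "S \<in> carrier_mat n n"
  shows "det (border a b (add_outer (1 / a) b S)) = a * det S"
proof -
  let ?s = "shear ((1 / a) \<cdot>\<^sub>v b)" and ?B = "border a (0\<^sub>v n) S"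
  have s: "?s \<in> carrier_mat (Suc n) (Suc n)" "transpose_mat ?s \<in> carrier_mat (Suc n) (Suc n)"
    and B: "?B \<in> carrier_mat (Suc n) (Suc n)"
    using assms by simp_all
  have "det (?s * ?B * transpose_mat ?s) = det ?s * det ?B * det ?s"
    using det_mult[OF mult_carrier_mat[OF s(1) B] s(2)] det_mult[OF s(1) B] det_transpose[OF s(1)]
    by simp
  then show ?thesis using assms by (simp add: border_add_outer det_border_zero)
qed

lemma transpose_add_outer:
  assumes "b \<in> carrier_vec n" "S \<in> carrier_mat n n"
  shows "transpose_mat (add_outer k b S) = add_outer k b (transpose_mat S)"
  using assms by (auto simp: add_outer_def mult_ac intro!: eq_matI)

lemma add_outer_add_outer:
  assumes "b \<in> carrier_vec n" "S \<in> carrier_mat n n"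
  shows "add_outer k b (add_outer l b S) = add_outer (k + l) b S"
  using assms by (auto simp: add_outer_def algebra_simps intro!: eq_matI)

lemma add_outer_0:
  assumes "b \<in> carrier_vec n" "S \<in> carrier_mat n n"
  shows "add_outer 0 b S = S"
  using assms by (auto simp: add_outer_def intro!: eq_matI)

text \<open>The parametrisation of the matrices with nonzero corner entry by corner, first row and Schur
  complement.\<close>

lemma bij_betw_schur:
  "bij_betw (\<lambda>(a, b, S). border a b (add_outer (1 / a) b S))
     ((UNIV - {0 :: 'a::field}) \<times> carrier_vec n \<times> invertible_sym_mats n)
     {A \<in> invertible_sym_mats (Suc n). A $$ (0, 0) \<noteq> 0}"
proof (rule bij_betw_imageI)
  let ?f = "\<lambda>(a :: 'a, b, S). border a b (add_outer (1 / a) b S)"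
  let ?D = "(UNIV - {0 :: 'a}) \<times> carrier_vec n \<times> invertible_sym_mats n"
  show "inj_on ?f ?D"
  proof (rule inj_onI)
    fix p p' assume D: "p \<in> ?D" "p' \<in> ?D" and eq: "?f p = ?f p'"
    obtain a b S a' b' S' where p: "p = (a, b, S)" "p' = (a', b', S')"
      by (metis prod_cases3)
    with D have *: "b \<in> carrier_vec n" "b' \<in> carrier_vec n" "S \<in> invertible_sym_mats n" "S' \<in> invertible_sym_mats n"
      by auto
    from eq * have ab: "a = a'" "b = b'" and outer: "add_outer (1 / a) b S = add_outer (1 / a) b S'"
      by (auto simp: p border_inject[of _ n] invertible_sym_matsD(1))
    from arg_cong[OF outer, of "add_outer (- (1 / a)) b"] * have "S = S'"
      by (simp add: add_outer_add_outer[of _ n] add_outer_0[of _ n] invertible_sym_matsD(1))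
    with ab show "p = p'" by (simp add: p)
  qed
  show "?f ` ?D = {A \<in> invertible_sym_mats (Suc n). A $$ (0, 0) \<noteq> 0}"
  proof (intro equalityI subsetI)
    fix A assume "A \<in> ?f ` ?D"
    then obtain a b S where *: "a \<noteq> 0" "b \<in> carrier_vec n" "S \<in> invertible_sym_mats n"
      and A: "A = border a b (add_outer (1 / a) b S)" by auto
    note S = invertible_sym_matsD[OF *(3)]
    have "transpose_mat (border a b (add_outer (1 / a) b S)) = border a b (add_outer (1 / a) b S)"
      using * S by (simp add: transpose_border[of _ n] transpose_add_outer[of _ n])
    with * S show "A \<in> {A \<in> invertible_sym_mats (Suc n). A $$ (0, 0) \<noteq> 0}"
      by (simp add: A invertible_sym_mats_iff det_border_add_outer[of _ _ n])
  next
    fix A :: "'a mat" assume "A \<in> {A \<in> invertible_sym_mats (Suc n). A $$ (0, 0) \<noteq> 0}"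
    then have A: "A \<in> invertible_sym_mats (Suc n)" and a: "A $$ (0, 0) \<noteq> 0" by auto
    obtain b C where bC: "b \<in> carrier_vec n" "C \<in> carrier_mat n n" "transpose_mat C = C"
      "A = border (A $$ (0, 0)) b C"
      using A sym_eq_border[of A n] by (auto simp: invertible_sym_mats_iff)
    let ?a = "A $$ (0, 0)"
    define S where "S = add_outer (- (1 / ?a)) b C"
    have S: "S \<in> carrier_mat n n" using bC by (simp add: S_def)
    have "add_outer (1 / ?a) b S = C"
      using bC by (simp add: S_def add_outer_add_outer[of _ n] add_outer_0[of _ n])
    then have AS: "A = border ?a b (add_outer (1 / ?a) b S)" using bC by simp
    have "det A = ?a * det S"
      by (subst AS) (rule det_border_add_outer[OF a bC(1) S])
    then have S': "S \<in> invertible_sym_mats n"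
      using bC S invertible_sym_matsD(3)[OF A] unfolding S_def
      by (auto simp: invertible_sym_mats_iff transpose_add_outer[of _ n])
    then show "A \<in> ?f ` ?D" using a bC S' AS by (intro image_eqI[of _ _ "(?a, b, S)"]) auto
  qed
qed

lemma mat_trace_border:
  fixes a :: "'a::comm_ring_1"
  assumes "b \<in> carrier_vec n" "C \<in> carrier_mat n n" "T \<in> carrier_mat n n"
  shows "mat_trace (border a b C * border t (0\<^sub>v n) T) = a * t + mat_trace (C * T)"
  using assms by (simp add: mat_trace_mult[of _ "Suc n"] mat_trace_mult[of _ n] sum.lessThan_Suc_shift
      del: sum.lessThan_Suc)

lemma mat_trace_add_outer:
  fixes k :: "'a::comm_ring_1"
  assumes "b \<in> carrier_vec n" "S \<in> carrier_mat n n" "T \<in> carrier_mat n n" "transpose_mat T = T"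
  shows "mat_trace (add_outer k b S * T) = mat_trace (S * T) + k * quad_form T b"
proof -
  have sym: "T $$ (j, i) = T $$ (i, j)" if "i < n" "j < n" for i j
    using assms that by (metis carrier_matD index_transpose_mat(1))
  have "mat_trace (add_outer k b S * T) = (\<Sum>i<n. \<Sum>j<n. (S $$ (i, j) + k * b $ i * b $ j) * T $$ (j, i))"
    using assms by (simp add: mat_trace_mult[of _ n]) (auto simp: add_outer_def)
  also have "\<dots> = mat_trace (S * T) + k * quad_form T b"
    using assms by (simp add: mat_trace_mult[of _ n] quad_form_sum[of _ n] distrib_right sum.distrib
        sum_distrib_left) (auto simp: sym mult_ac intro!: sum.cong)
  finally show ?thesis .
qed

lemma quad_form_border:
  assumes "T \<in> carrier_mat n n" "v \<in> carrier_vec n"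
  shows "quad_form (border t (0\<^sub>v n) T) (vCons x v) = t * x\<^sup>2 + quad_form T v"
  using assms by (simp add: quad_form_sum[of _ "Suc n"] quad_form_sum[of _ n] sum.lessThan_Suc_shift
      power2_eq_square mult_ac del: sum.lessThan_Suc)

section \<open>Diagonalisation and representation numbers\<close>

lemma quad_form_add:
  fixes T :: "'a::comm_ring_1 mat"
  assumes T: "T \<in> carrier_mat n n" "transpose_mat T = T" and u: "u \<in> carrier_vec n" and v: "v \<in> carrier_vec n"
  shows "quad_form T (u + v) = quad_form T u + quad_form T v + 2 * (u \<bullet> (T *\<^sub>v v))"
proof -
  have Tu: "T *\<^sub>v u \<in> carrier_vec n" and Tv: "T *\<^sub>v v \<in> carrier_vec n"
    using T u v by auto
  have "v \<bullet> (T *\<^sub>v u) = u \<bullet> (T *\<^sub>v v)"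
    using transpose_vec_mult_scalar[OF T(1) u v] comm_scalar_prod[OF u Tv] T(2) by simp
  then show ?thesis
    unfolding quad_form_def mult_add_distrib_mat_vec[OF T(1) u v]
      scalar_prod_add_distrib[OF add_carrier_vec[OF u v] Tu Tv]
      add_scalar_prod_distrib[OF u v Tu] add_scalar_prod_distrib[OF u v Tv]
    by (simp only: mult_2 add.assoc add.commute add.left_commute)
qed

text \<open>If all values of the form vanish, then so do all values of its polarisation, since \<open>2 \<noteq> 0\<close>; in
  particular the first row of \<open>T\<close> is zero.\<close>

lemma anisotropic_vector_exists:
  fixes T :: "'a::field mat"
  assumes two: "(2::'a) \<noteq> 0" and T: "T \<in> invertible_sym_mats (Suc n)"
  shows "\<exists>v\<in>carrier_vec (Suc n). quad_form T v \<noteq> 0"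
proof (rule ccontr)
  assume "\<not> ?thesis"
  then have iso: "quad_form T v = 0" if "v \<in> carrier_vec (Suc n)" for v using that by auto
  note T' = invertible_sym_matsD[OF T]
  have "T $$ (0, j) = 0" if j: "j < Suc n" for j
  proof -
    let ?u = "unit_vec (Suc n) 0 :: 'a vec" and ?v = "unit_vec (Suc n) j :: 'a vec"
    have "?u \<bullet> (T *\<^sub>v ?v) = T $$ (0, j)"
      using T'(1) j by (subst scalar_prod_left_unit[of _ "Suc n"]) auto
    with quad_form_add[OF T'(1,2), of ?u ?v] two show ?thesis by (simp add: iso)
  qed
  then have "det T = 0" using T' by (subst laplace_expansion_row[of _ "Suc n" 0]) (auto intro!: sum.neutral)
  with T' show False by simp
qed

text \<open>Replace a column of the identity matrix whose index is the position of a nonzero entry of \<open>v\<close>, then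
  move this column to the front.\<close>

lemma invertible_mat_with_first_col:
  fixes v :: "'a::field vec"
  assumes v: "v \<in> carrier_vec (Suc n)" "v \<noteq> 0\<^sub>v (Suc n)"
  obtains g where "g \<in> carrier_mat (Suc n) (Suc n)" "det g \<noteq> 0" "col g 0 = v"
proof -
  obtain j where j: "j < Suc n" "v $ j \<noteq> 0"
    using v by (metis carrier_vecD eq_vecI index_zero_vec)
  define R where "R = replace_col (1\<^sub>m (Suc n)) v j"
  have R: "R \<in> carrier_mat (Suc n) (Suc n)" by (simp add: R_def replace_col_def)
  have col_R: "col R j = v" using v j by (intro eq_vecI) (auto simp: R_def replace_col_def)
  have det_R: "det R = v $ j"
    using cramer_lemma_mat[of "1\<^sub>m (Suc n)" "Suc n" v j] v j by (simp add: R_def)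
  show ?thesis
  proof (cases "j = 0")
    case True
    with R det_R col_R j show ?thesis by (intro that[of R]) auto
  next
    case False
    show ?thesis
    proof (intro that[of "swapcols 0 j R"])
      show "col (swapcols 0 j R) 0 = v"
        using R col_R j by (intro eq_vecI) (auto simp: mat_swapcols_def)
      have "swapcols 0 j R = R * swaprows_mat (Suc n) 0 j"
        using R j by (intro swapcols_mat) auto
      then show "det (swapcols 0 j R) \<noteq> 0"
        using R j False det_R by (simp add: det_mult[of _ "Suc n"] det_swaprows_mat)
    qed (use R in auto)
  qed
qed

lemma border_zero_invertible_sym:
  fixes t :: "'a::field"
  assumes "t \<noteq> 0" "T \<in> invertible_sym_mats n"
  shows "border t (0\<^sub>v n) T \<in> invertible_sym_mats (Suc n)"
  using assms invertible_sym_matsD[OF assms(2)]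
  by (auto simp: invertible_sym_mats_iff transpose_border[of _ n] det_border_zero)

text \<open>Diagonalisation as an induction rule: a property that is stable under congruence and under adding a
  one-dimensional orthogonal summand holds for all invertible symmetric matrices. In the step, a
  congruence makes the corner entry nonzero, and a shear then clears the first row.\<close>

lemma invertible_sym_mats_induct [consumes 2, case_names zero border congruence]:
  fixes T :: "'a::field mat"
  assumes two: "(2::'a) \<noteq> 0" and "T \<in> invertible_sym_mats n"
    and zero: "\<And>T. T \<in> carrier_mat 0 0 \<Longrightarrow> P 0 T"
    and border: "\<And>n t T. t \<noteq> 0 \<Longrightarrow> T \<in> invertible_sym_mats n \<Longrightarrow> P n T \<Longrightarrow> P (Suc n) (border t (0\<^sub>v n) T)"
    and congruence: "\<And>n g T. T \<in> invertible_sym_mats n \<Longrightarrow> g \<in> carrier_mat n n \<Longrightarrow> det g \<noteq> 0 \<Longrightarrow>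
      P n T \<Longrightarrow> P n (transpose_mat g * T * g)"
  shows "P n T"
  using assms(2)
proof (induction n arbitrary: T)
  case 0
  then show ?case by (intro zero) (auto dest: invertible_sym_matsD)
next
  case (Suc n)
  obtain v where v: "v \<in> carrier_vec (Suc n)" "quad_form T v \<noteq> 0"
    using anisotropic_vector_exists[OF two Suc.prems] by auto
  then have "v \<noteq> 0\<^sub>v (Suc n)"
    using invertible_sym_matsD[OF Suc.prems] by (auto simp: quad_form_def)
  with v obtain g where g: "g \<in> carrier_mat (Suc n) (Suc n)" "det g \<noteq> 0" "col g 0 = v"
    using invertible_mat_with_first_col by blast
  let ?T = "transpose_mat g * T * g"
  have "?T \<in> {A \<in> invertible_sym_mats (Suc n). A $$ (0, 0) \<noteq> 0}"
    using g v congruence_invertible_sym[OF Suc.prems g(1,2)] congruence_entry_0[of T n g]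
      invertible_sym_matsD[OF Suc.prems] by simp
  then have "?T \<in> (\<lambda>(a, b, S). border a b (add_outer (1 / a) b S)) `
      ((UNIV - {0}) \<times> carrier_vec n \<times> invertible_sym_mats n)"
    by (simp only: bij_betw_imp_surj_on[OF bij_betw_schur])
  then obtain a b S where a: "a \<noteq> 0" and b: "b \<in> carrier_vec n" and S: "S \<in> invertible_sym_mats n"
    and T: "?T = border a b (add_outer (1 / a) b S)" by auto
  let ?s = "transpose_mat (shear ((1 / a) \<cdot>\<^sub>v b))"
  have s: "?s \<in> carrier_mat (Suc n) (Suc n)" "det ?s = 1"
    using b by (simp_all add: det_transpose[of _ "Suc n"])
  have "border a (0\<^sub>v n) S \<in> invertible_sym_mats (Suc n)"
    by (rule border_zero_invertible_sym[OF a S])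
  from congruence[OF this s(1)] s(2) border[OF a S Suc.IH[OF S]]
  have PT: "P (Suc n) ?T" by (simp add: T border_add_outer[OF a b])
  obtain h where h: "h \<in> carrier_mat (Suc n) (Suc n)" "g * h = 1\<^sub>m (Suc n)" "det h \<noteq> 0"
    using inverse_mat_exists[OF g(1,2)] by blast
  from congruence[OF congruence_invertible_sym(1)[OF Suc.prems g(1,2)] h(1,3) PT]
  show ?case
    by (simp only: congruence_inverse[OF invertible_sym_matsD(1)[OF Suc.prems] g(1) h(1,2)])
qed

definition quad_count :: "nat \<Rightarrow> 'a::comm_ring_1 mat \<Rightarrow> 'a \<Rightarrow> real" where
  "quad_count n T s = real (card {v \<in> carrier_vec n. quad_form T v = s})"

text \<open>The deviation from the mean \<open>q\<^sup>n / q\<close> of the number of representations of \<open>s\<close> by an \<open>n\<close>-dimensional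
  form of determinant \<open>D\<close>.\<close>

definition quad_dev :: "nat \<Rightarrow> 'a::{field,finite} \<Rightarrow> 'a \<Rightarrow> real" where
  "quad_dev n D s = real CARD('a) ^ (n div 2) * quad_char ((- 1) ^ (n div 2) * D) *
     (if even n then of_bool (s = 0) - 1 / real CARD('a) else quad_char s)"

lemma quad_count_congruence:
  fixes T :: "'a::{field,finite} mat"
  assumes "T \<in> carrier_mat n n" "g \<in> carrier_mat n n" "det g \<noteq> 0"
  shows "quad_count n (transpose_mat g * T * g) s = quad_count n T s"
proof -
  have "(\<Sum>v\<in>carrier_vec n. of_bool (quad_form T (g *\<^sub>v v) = s)) =
      (\<Sum>v\<in>carrier_vec n. of_bool (quad_form T v = s) :: real)"
    by (rule sum.reindex_bij_betw[OF bij_betw_mult_mat_vec[OF assms(2,3)]])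
  then show ?thesis
    by (simp only: quad_count_def real_card_eq_sum[OF finite_carrier_vec] quad_form_congruence[OF assms(1,2)] cong: sum.cong)
qed

lemma quad_count_border:
  fixes T :: "'a::{field,finite} mat"
  assumes "T \<in> carrier_mat n n"
  shows "quad_count (Suc n) (border t (0\<^sub>v n) T) s = (\<Sum>x\<in>UNIV. quad_count n T (s - t * x\<^sup>2))"
proof -
  have "quad_count (Suc n) (border t (0\<^sub>v n) T) s =
      (\<Sum>x\<in>UNIV. \<Sum>v\<in>carrier_vec n. of_bool (t * x\<^sup>2 + quad_form T v = s))"
    unfolding quad_count_def real_card_eq_sum[OF finite_carrier_vec] sum_carrier_vec_Suc
    using assms by (intro sum.cong refl) (simp only: quad_form_border)
  also have "\<dots> = (\<Sum>x\<in>UNIV. quad_count n T (s - t * x\<^sup>2))"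
    unfolding quad_count_def real_card_eq_sum[OF finite_carrier_vec]
    by (intro sum.cong refl) (simp add: eq_diff_eq add.commute)
  finally show ?thesis .
qed

text \<open>Adding a summand \<open>t x\<^sup>2\<close> to an even-dimensional form counts the square roots of \<open>s / t\<close>, which gives
  the character; adding it to an odd-dimensional form gives the sum of \<open>quad_char (x\<^sup>2 - s / t)\<close>.\<close>

lemma quad_count_eq:
  fixes T :: "'a::{field,finite} mat"
  assumes two: "(2::'a) \<noteq> 0" and T: "T \<in> invertible_sym_mats n"
  shows "quad_count n T s = real CARD('a) ^ n / real CARD('a) + quad_dev n (det T) s"
  using two T
proof (induction n T arbitrary: s rule: invertible_sym_mats_induct)
  case (zero T)
  have "quad_form T v = 0" if "v \<in> carrier_vec 0" for v
    using that zero by (simp add: quad_form_sum[of _ 0])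
  then have "{v \<in> carrier_vec 0. quad_form T v = s} = (if s = 0 then {vNil} else {})" by auto
  with zero show ?case by (simp add: quad_count_def quad_dev_def)
next
  case (border n t T)
  let ?q = "real CARD('a)"
  note T = invertible_sym_matsD[OF border(2)]
  have D: "det (border t (0\<^sub>v n) T) = t * det T" using T by (simp add: det_border_zero)
  have "quad_count (Suc n) (border t (0\<^sub>v n) T) s =
      (\<Sum>x\<in>UNIV. ?q ^ n / ?q + quad_dev n (det T) (s - t * x\<^sup>2))"
    by (simp only: quad_count_border[OF T(1)] border.IH)
  also have "\<dots> = ?q ^ Suc n / ?q + (\<Sum>x\<in>UNIV. quad_dev n (det T) (s - t * x\<^sup>2))"
    by (simp add: sum.distrib)
  also have "(\<Sum>x\<in>UNIV. quad_dev n (det T) (s - t * x\<^sup>2)) = quad_dev (Suc n) (t * det T) s"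
  proof (cases "even n")
    case True
    have "(\<Sum>x\<in>UNIV. of_bool (s - t * x\<^sup>2 = 0)) = real (card {x\<in>UNIV. s - t * x\<^sup>2 = 0})"
      by (simp only: real_card_eq_sum[OF finite])
    also have "{x\<in>UNIV. s - t * x\<^sup>2 = 0} = {x. x\<^sup>2 = s / t}"
      using border(1) by (auto simp: field_simps)
    also have "real (card \<dots>) = 1 + quad_char s * quad_char t"
      using two by (simp add: card_square_roots quad_char_divide)
    finally have "(\<Sum>x\<in>UNIV. of_bool (s - t * x\<^sup>2 = 0) - 1 / ?q) = quad_char s * quad_char t"
      by (simp only: sum_subtractf) simp
    then show ?thesis using True
      by (simp only: quad_dev_def sum_distrib_left[symmetric] if_True even_Suc not_True_eq_False if_False
          even_Suc_div_two quad_char_mult[OF two]) simp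
  next
    case False
    have "quad_char (s - t * x\<^sup>2) = quad_char (- t) * quad_char (x\<^sup>2 - s / t)" for x
    proof -
      have "s - t * x\<^sup>2 = (- t) * (x\<^sup>2 - s / t)" using border(1) by (simp add: right_diff_distrib)
      then show ?thesis by (simp only: quad_char_mult[OF two])
    qed
    then have "(\<Sum>x\<in>UNIV. quad_char (s - t * x\<^sup>2)) = quad_char (- t) * ((if s / t = 0 then ?q else 0) - 1)"
      by (simp only: sum_distrib_left[symmetric] sum_quad_char_square_minus[OF two])
    also have "\<dots> = quad_char (- 1 * t) * ?q * (of_bool (s = 0) - 1 / ?q)"
      using border(1) by (simp add: field_simps)
    finally show ?thesis using False
      by (simp only: quad_dev_def sum_distrib_left[symmetric] if_True even_Suc not_False_eq_True if_False
          odd_Suc_div_two[of n] quad_char_mult[OF two] power_Suc) (simp add: quad_char_mult[OF two])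
  qed
  finally show ?case by (simp only: D)
next
  case (congruence n g T)
  have "quad_dev n (det (transpose_mat g * T * g)) s = quad_dev n (det T) s"
    using congruence by (simp add: congruence_invertible_sym(2) quad_dev_def quad_char_mult[OF two])
  then show ?case
    by (simp only: quad_count_congruence[OF invertible_sym_matsD(1)[OF congruence(1)] congruence(2,3)] congruence.IH)
qed

text \<open>For a function of sum \<open>0\<close> the main term of the representation numbers drops out.\<close>

lemma sum_quad_form:
  fixes T :: "'a::{field,finite} mat"
  assumes two: "(2::'a) \<noteq> 0" and T: "T \<in> invertible_sym_mats n" and f: "(\<Sum>s\<in>UNIV. f s) = 0"
  shows "(\<Sum>v\<in>carrier_vec n. f (quad_form T v)) = (\<Sum>s\<in>UNIV. quad_dev n (det T) s * f s)"
proof -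
  have "(\<Sum>v\<in>carrier_vec n. f (quad_form T v)) =
      (\<Sum>v\<in>carrier_vec n. \<Sum>s\<in>UNIV. of_bool (s = quad_form T v) * f s)"
    by (simp only: mult_sum_of_bool_eq(2)[OF finite] UNIV_I if_True)
  also have "\<dots> = (\<Sum>s\<in>UNIV. \<Sum>v\<in>carrier_vec n. of_bool (s = quad_form T v) * f s)"
    by (rule sum.swap)
  also have "\<dots> = (\<Sum>s\<in>UNIV. quad_count n T s * f s)"
    unfolding quad_count_def real_card_eq_sum[OF finite_carrier_vec] sum_distrib_right
    by (intro sum.cong refl) auto
  also have "\<dots> = (\<Sum>s\<in>UNIV. quad_dev n (det T) s * f s) + real CARD('a) ^ n / real CARD('a) * (\<Sum>s\<in>UNIV. f s)"
    by (simp only: quad_count_eq[OF two T] distrib_right sum.distrib sum_distrib_left add.commute)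
  finally show ?thesis using f by simp
qed

section \<open>The number of symmetric matrices of given determinant\<close>

definition sym_count :: "nat \<Rightarrow> 'a::{field,finite} \<Rightarrow> real" where
  "sym_count n d = real (card {A \<in> invertible_sym_mats n. det A = d})"

definition trace_count :: "nat \<Rightarrow> 'a::{field,finite} mat \<Rightarrow> 'a \<Rightarrow> 'a \<Rightarrow> real" where
  "trace_count n T d t = real (card {A \<in> invertible_sym_mats n. det A = d \<and> mat_trace (A * T) = t})"

text \<open>Subtracting the mean makes the recursion on the size of \<open>T\<close> homogeneous, see \<open>trace_dev_border\<close>.\<close>

definition trace_dev :: "nat \<Rightarrow> 'a::{field,finite} mat \<Rightarrow> 'a \<Rightarrow> 'a \<Rightarrow> real" where
  "trace_dev n T d t = trace_count n T d t - sym_count n d / real CARD('a)"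

lemma sym_count_eq_sum: "sym_count n d = (\<Sum>A\<in>invertible_sym_mats n. of_bool (det A = d))"
  by (simp only: sym_count_def real_card_eq_sum[OF finite_invertible_sym_mats])

lemma trace_count_eq_sum:
  "trace_count n T d t = (\<Sum>A\<in>invertible_sym_mats n. of_bool (det A = d) * of_bool (mat_trace (A * T) = t))"
  by (simp only: trace_count_def real_card_eq_sum[OF finite_invertible_sym_mats] of_bool_conj)

lemma sum_trace_count: "(\<Sum>t\<in>UNIV. trace_count n T d t) = sym_count n d"
proof -
  have "(\<Sum>t\<in>UNIV. trace_count n T d t) =
      (\<Sum>A\<in>invertible_sym_mats n. \<Sum>t\<in>UNIV. of_bool (det A = d) * of_bool (t = mat_trace (A * T)))"
    unfolding trace_count_eq_sum by (subst sum.swap) (simp only: eq_commute)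
  also have "\<dots> = sym_count n d"
    by (simp only: mult_sum_of_bool_eq(1)[OF finite] UNIV_I if_True sym_count_eq_sum)
  finally show ?thesis .
qed

lemma sum_trace_dev: "(\<Sum>t\<in>UNIV. trace_dev n (T :: 'a::{field,finite} mat) d t) = 0"
  by (simp add: trace_dev_def sum_subtractf sum_trace_count)

lemma sum_invertible_sym_schur:
  "(\<Sum>A | A \<in> invertible_sym_mats (Suc n) \<and> A $$ (0, 0) \<noteq> 0. F A) =
   (\<Sum>a\<in>UNIV - {0 :: 'a::{field,finite}}. \<Sum>b\<in>carrier_vec n. \<Sum>S\<in>invertible_sym_mats n.
      F (border a b (add_outer (1 / a) b S)) :: real)"
  using sum.reindex_bij_betw[OF bij_betw_schur, of F n]
  by (simp add: sum.cartesian_product case_prod_unfold)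

text \<open>The substitution \<open>A \<mapsto> g A g\<^sup>T\<close> moves a congruence from \<open>T\<close> to \<open>A\<close>, because the trace is cyclic.\<close>

lemma trace_dev_congruence:
  fixes T :: "'a::{field,finite} mat"
  assumes T: "T \<in> carrier_mat n n" and g: "g \<in> carrier_mat n n" "det g \<noteq> 0"
  shows "trace_dev n (transpose_mat g * T * g) d t = trace_dev n T ((det g)\<^sup>2 * d) t"
proof -
  let ?h = "transpose_mat g"
  have h: "?h \<in> carrier_mat n n" "det ?h = det g" using g by (simp_all add: det_transpose[of _ n])
  have det: "det (transpose_mat ?h * A * ?h) = (det g)\<^sup>2 * d \<longleftrightarrow> det A = d" if "A \<in> invertible_sym_mats n" for A
    using congruence_invertible_sym(2)[OF that h(1)] h g by simp
  have trace: "mat_trace (transpose_mat ?h * A * ?h * T) = mat_trace (A * (transpose_mat g * T * g))"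
    if "A \<in> invertible_sym_mats n" for A
  proof -
    note A = invertible_sym_matsD(1)[OF that]
    have "mat_trace (transpose_mat ?h * A * ?h * T) = mat_trace (g * (A * (?h * T)))"
      using A T g by (simp add: assoc_mult_mat[of _ n n _ n _ n])
    also have "\<dots> = mat_trace ((A * (?h * T)) * g)"
      using A T g by (intro mat_trace_commute[of _ n]) auto
    also have "\<dots> = mat_trace (A * (transpose_mat g * T * g))"
      using A T g by (simp add: assoc_mult_mat[of _ n n _ n _ n])
    finally show ?thesis .
  qed
  have "det ?h \<noteq> 0" using h g by simp
  note reindex = sum.reindex_bij_betw[OF bij_betw_congruence[OF h(1) this], symmetric]
  have "sym_count n ((det g)\<^sup>2 * d) = sym_count n d"
    unfolding sym_count_eq_sum by (subst reindex) (simp only: det cong: sum.cong)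
  moreover have "trace_count n T ((det g)\<^sup>2 * d) t = trace_count n (transpose_mat g * T * g) d t"
    unfolding trace_count_eq_sum by (subst reindex) (simp only: det trace cong: sum.cong)
  ultimately show ?thesis by (simp add: trace_dev_def)
qed

text \<open>A congruence moves \<open>v\<close> to the first unit vector and rescales \<open>d\<close>. The matrices with nonzero corner
  entry and determinant \<open>d\<close> correspond to arbitrary first rows and Schur complements, because the
  corner entry can be solved for; so the count is the same for all nonzero \<open>d\<close> and \<open>v\<close>.\<close>

lemma card_nonisotropic_at_vector:
  fixes v :: "'a::{field,finite} vec"
  assumes d: "d \<noteq> 0" and v: "v \<in> carrier_vec (Suc n)" "v \<noteq> 0\<^sub>v (Suc n)"
  shows "(\<Sum>A\<in>invertible_sym_mats (Suc n). of_bool (det A = d) * of_bool (quad_form A v \<noteq> 0)) =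
    real CARD('a) ^ n * real (card (invertible_sym_mats n :: 'a mat set))" (is "?L = _")
proof -
  obtain g where g: "g \<in> carrier_mat (Suc n) (Suc n)" "det g \<noteq> 0" "col g 0 = v"
    using invertible_mat_with_first_col[OF v] by blast
  let ?d = "(det g)\<^sup>2 * d"
  have eq: "of_bool (det (transpose_mat g * A * g) = ?d) * of_bool ((transpose_mat g * A * g) $$ (0, 0) \<noteq> 0) =
      (of_bool (det A = d) * of_bool (quad_form A v \<noteq> 0) :: real)" if "A \<in> invertible_sym_mats (Suc n)" for A
    using g congruence_invertible_sym(2)[OF that g(1,2)] congruence_entry_0[of A n g]
      invertible_sym_matsD[OF that] by simp
  have "?L = (\<Sum>A\<in>invertible_sym_mats (Suc n). of_bool (det A = ?d) * of_bool (A $$ (0, 0) \<noteq> 0))"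
    by (subst sum.reindex_bij_betw[OF bij_betw_congruence[OF g(1,2)], symmetric])
      (simp only: eq cong: sum.cong)
  also have "\<dots> = (\<Sum>A | A \<in> invertible_sym_mats (Suc n) \<and> A $$ (0, 0) \<noteq> 0. of_bool (det A = ?d))"
    by (rule sum.mono_neutral_cong_right) auto
  also have "\<dots> = (\<Sum>a\<in>UNIV - {0}. \<Sum>b\<in>(carrier_vec n :: 'a vec set). \<Sum>S\<in>invertible_sym_mats n. of_bool (a = ?d / det S))"
    unfolding sum_invertible_sym_schur
  proof (intro sum.cong refl)
    fix a :: 'a and b :: "'a vec" and S :: "'a mat"
    assume *: "a \<in> UNIV - {0}" "b \<in> carrier_vec n" "S \<in> invertible_sym_mats n"
    then show "of_bool (det (border a b (add_outer (1 / a) b S)) = ?d) = (of_bool (a = ?d / det S) :: real)"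
      using invertible_sym_matsD[OF *(3)] by (simp add: det_border_add_outer[of _ _ n] eq_divide_eq)
  qed
  also have "\<dots> = (\<Sum>b\<in>(carrier_vec n :: 'a vec set). \<Sum>S\<in>invertible_sym_mats n. \<Sum>a\<in>UNIV - {0}. of_bool (a = ?d / det S) * 1)"
    by (subst sum.swap) (simp only: mult_1_right sum.swap[of _ "UNIV - {0}"])
  also have "\<dots> = (\<Sum>b\<in>(carrier_vec n :: 'a vec set). \<Sum>S\<in>(invertible_sym_mats n :: 'a mat set). 1)"
  proof (intro sum.cong refl)
    fix S :: "'a mat" assume "S \<in> invertible_sym_mats n"
    then have "?d / det S \<in> UNIV - {0}" using d g invertible_sym_matsD[of S n] by auto
    then show "(\<Sum>a\<in>UNIV - {0}. of_bool (a = ?d / det S) * 1) = (1 :: real)"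
      by (simp only: mult_sum_of_bool_eq(2)[OF finite] if_True)
  qed
  also have "\<dots> = real CARD('a) ^ n * real (card (invertible_sym_mats n :: 'a mat set))"
    by (simp add: card_carrier_vec)
  finally show ?thesis .
qed

text \<open>Both sides count the pairs of a matrix \<open>A\<close> of determinant \<open>d\<close> and a vector \<open>v\<close> with
  \<open>quad_form A v \<noteq> 0\<close>. The number of such \<open>v\<close> only depends on \<open>d\<close>, and the number of such \<open>A\<close> is the
  same for all \<open>v \<noteq> 0\<close>.\<close>

lemma sym_count_recursion:
  fixes d :: "'a::{field,finite}"
  assumes two: "(2::'a) \<noteq> 0" and d: "d \<noteq> 0"
  shows "sym_count (Suc n) d * (real CARD('a) ^ Suc n - real CARD('a) ^ n - quad_dev (Suc n) d 0) =
    (real CARD('a) ^ Suc n - 1) * real CARD('a) ^ n * real (card (invertible_sym_mats n :: 'a mat set))"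
proof -
  let ?q = "real CARD('a)" and ?V = "carrier_vec (Suc n) :: 'a vec set"
  let ?S = "\<Sum>A\<in>invertible_sym_mats (Suc n). \<Sum>v\<in>?V. of_bool (det A = d) * of_bool (quad_form A v \<noteq> 0)"
  have nonisotropic: "(\<Sum>v\<in>?V. of_bool (quad_form A v \<noteq> 0)) = ?q ^ Suc n - ?q ^ n - quad_dev (Suc n) (det A) 0"
    if "A \<in> invertible_sym_mats (Suc n)" for A
  proof -
    have "(\<Sum>v\<in>?V. of_bool (quad_form A v \<noteq> 0)) = (\<Sum>v\<in>?V. 1 - of_bool (quad_form A v = 0) :: real)"
      by (intro sum.cong) auto
    also have "\<dots> = ?q ^ Suc n - quad_count (Suc n) A 0"
      by (simp only: sum_subtractf quad_count_def real_card_eq_sum[OF finite_carrier_vec])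
        (simp add: card_carrier_vec)
    finally show ?thesis by (simp add: quad_count_eq[OF two that])
  qed
  have zero: "quad_form A (0\<^sub>v (Suc n)) = 0" if "A \<in> invertible_sym_mats (Suc n)" for A :: "'a mat"
    using invertible_sym_matsD(1)[OF that]
    by (simp add: quad_form_def scalar_prod_left_zero[OF mult_mat_vec_carrier[of A "Suc n" "Suc n"]])
  have "?S = (\<Sum>A\<in>invertible_sym_mats (Suc n). of_bool (det A = d) * (?q ^ Suc n - ?q ^ n - quad_dev (Suc n) d 0))"
    by (intro sum.cong refl) (simp only: sum_distrib_left[symmetric] nonisotropic, simp)
  then have S: "?S = sym_count (Suc n) d * (?q ^ Suc n - ?q ^ n - quad_dev (Suc n) d 0)"
    by (simp only: sum_distrib_right[symmetric] sym_count_eq_sum)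
  have "sym_count (Suc n) d * (?q ^ Suc n - ?q ^ n - quad_dev (Suc n) d 0) = ?S" by (rule S[symmetric])
  also have "?S = (\<Sum>v\<in>?V. \<Sum>A\<in>invertible_sym_mats (Suc n). of_bool (det A = d) * of_bool (quad_form A v \<noteq> 0))"
    by (rule sum.swap)
  also have "(\<Sum>v\<in>?V. \<Sum>A\<in>invertible_sym_mats (Suc n). of_bool (det A = d) * of_bool (quad_form A v \<noteq> 0)) =
      (\<Sum>v\<in>?V - {0\<^sub>v (Suc n)}. ?q ^ n * real (card (invertible_sym_mats n :: 'a mat set)))"
  proof (rule sum.mono_neutral_cong_right)
    show "\<forall>v\<in>?V - (?V - {0\<^sub>v (Suc n)}).
      (\<Sum>A\<in>invertible_sym_mats (Suc n). of_bool (det A = d) * of_bool (quad_form A v \<noteq> 0)) = (0 :: real)"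
      by (auto intro!: sum.neutral simp: zero)
  qed (use card_nonisotropic_at_vector[OF d] in auto)
  also have "\<dots> = (?q ^ Suc n - 1) * ?q ^ n * real (card (invertible_sym_mats n :: 'a mat set))"
    by (simp add: card_Diff_singleton card_carrier_vec of_nat_diff algebra_simps)
  finally show ?thesis .
qed

lemma sum_sym_count: "(\<Sum>d\<in>UNIV - {0}. sym_count n (d::'a::{field,finite})) = real (card (invertible_sym_mats n :: 'a mat set))"
proof -
  have "(\<Sum>d\<in>UNIV - {0::'a}. sym_count n d) = (\<Sum>A\<in>(invertible_sym_mats n :: 'a mat set). \<Sum>d\<in>UNIV - {0}. of_bool (d = det A) * 1)"
    unfolding sym_count_eq_sum by (subst sum.swap) (simp only: eq_commute mult_1_right)
  also have "\<dots> = (\<Sum>A\<in>(invertible_sym_mats n :: 'a mat set). 1)"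
    by (intro sum.cong refl, subst mult_sum_of_bool_eq(2)) (auto simp: invertible_sym_matsD(3))
  finally show ?thesis by simp
qed

text \<open>In odd size the number of isotropic vectors does not depend on \<open>d\<close>, and neither does the count. In
  even size \<open>2 m\<close>, with \<open>\<epsilon> = \<eta>((- 1)\<^sup>m d)\<close>, the number of nonisotropic vectors contains the factor
  \<open>q\<^sup>m - \<epsilon>\<close>, which divides \<open>q\<^bsup>2 m\<^esup> - 1 = (q\<^sup>m - \<epsilon>) (q\<^sup>m + \<epsilon>)\<close>.
  In size \<open>0\<close> only \<open>d = 1\<close> occurs, so the even shape starts at size \<open>2\<close>.\<close>

lemma sym_count_closed_form:
  fixes d :: "'a::{field,finite}"
  assumes two: "(2::'a) \<noteq> 0" and "d \<noteq> 0"
  defines "q \<equiv> real CARD('a)"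
  defines "P \<equiv> \<lambda>m. \<Prod>k<m. q ^ (2 * k + 1) - 1"
  shows "real (card (invertible_sym_mats (2 * m) :: 'a mat set)) = q ^ (m\<^sup>2 + m) * P m"
    and "sym_count (2 * m + 1) d = q ^ (m\<^sup>2 + m) * P (Suc m) / (q - 1)"
    and "sym_count (2 * Suc m) d =
      q ^ ((Suc m)\<^sup>2) * (q ^ Suc m + quad_char ((- 1) ^ Suc m * d)) * P (Suc m) / (q - 1)"
proof -
  have q1: "q > 1" unfolding q_def by (rule one_less_card_field)
  have odd: "sym_count (2 * m + 1) d = q ^ (m\<^sup>2 + m) * P (Suc m) / (q - 1)"
    if IH: "real (card (invertible_sym_mats (2 * m) :: 'a mat set)) = q ^ (m\<^sup>2 + m) * P m" and d: "d \<noteq> 0" for m and d :: 'a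
  proof -
    have "q ^ (2 * m) * (sym_count (2 * m + 1) d * (q - 1)) = q ^ (2 * m) * (q ^ (m\<^sup>2 + m) * P (Suc m))"
      using sym_count_recursion[OF two d, of "2 * m", folded q_def, unfolded IH]
      by (simp add: quad_dev_def P_def algebra_simps)
    then have "sym_count (2 * m + 1) d * (q - 1) = q ^ (m\<^sup>2 + m) * P (Suc m)"
      using q1 by (subst (asm) mult_left_cancel) auto
    then show ?thesis using q1 by (simp add: eq_divide_eq)
  qed
  have even: "sym_count (2 * Suc m) d =
      q ^ ((Suc m)\<^sup>2) * (q ^ Suc m + quad_char ((- 1) ^ Suc m * d)) * P (Suc m) / (q - 1)"
    if IH: "real (card (invertible_sym_mats (2 * m + 1) :: 'a mat set)) = q ^ (m\<^sup>2 + m) * P (Suc m)" and d: "d \<noteq> 0" for m and d :: 'a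
  proof -
    define e where "e = quad_char ((- 1) ^ Suc m * d)"
    have e: "e = 1 \<or> e = - 1" unfolding e_def by (rule quad_char_cases) (simp add: d)
    have "q ^ Suc m > 1" using q1 by (rule one_less_power) simp
    then have ne: "q ^ Suc m - e \<noteq> 0" using e by (auto simp del: power_Suc)
    \<comment> \<open>The deviation at 0 has the indicator term 1 - 1 / q, which merges with the difference of the two powers of q.\<close>
    have dev: "quad_dev (Suc (Suc (2 * m))) d 0 = e * q ^ m * (q - 1)"
      using q1 by (simp add: quad_dev_def q_def[symmetric] e_def field_simps)
    have pw: "q ^ (2 * m) = q ^ m * q ^ m" by (simp add: mult_2 power_add)
    have fac: "q ^ Suc (Suc (2 * m)) - q ^ Suc (2 * m) - e * q ^ m * (q - 1) = (q - 1) * q ^ m * (q ^ Suc m - e)"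
      by (simp only: power_Suc pw) (simp add: algebra_simps)
    have "e * e = 1" using e by auto
    then have diff: "q ^ Suc (Suc (2 * m)) - 1 = (q ^ Suc m - e) * (q ^ Suc m + e)"
      by (simp only: power_Suc pw) (simp add: algebra_simps)
    have "sym_count (Suc (Suc (2 * m))) d * (q ^ Suc (Suc (2 * m)) - q ^ Suc (2 * m) - e * q ^ m * (q - 1)) =
        (q ^ Suc (Suc (2 * m)) - 1) * q ^ Suc (2 * m) * (q ^ (m\<^sup>2 + m) * P (Suc m))"
      using sym_count_recursion[OF two d, of "2 * m + 1", folded q_def, unfolded IH]
      by (simp only: Suc_eq_plus1[symmetric] dev)
    then have "sym_count (2 * Suc m) d * ((q - 1) * q ^ m * (q ^ Suc m - e)) =
        (q ^ Suc m - e) * (q ^ Suc m + e) * (q ^ Suc (2 * m) * q ^ (m\<^sup>2 + m)) * P (Suc m)"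
      unfolding fac diff by (simp only: mult_Suc_right add_2_eq_Suc mult.assoc)
    also have "q ^ Suc (2 * m) * q ^ (m\<^sup>2 + m) = q ^ m * q ^ ((Suc m)\<^sup>2)"
      unfolding power_add[symmetric]
      by (intro arg_cong[of _ _ "power q"]) (simp add: power2_eq_square)
    finally have "(q ^ m * (sym_count (2 * Suc m) d * (q - 1))) * (q ^ Suc m - e) =
       (q ^ m * (q ^ ((Suc m)\<^sup>2) * (q ^ Suc m + e) * P (Suc m))) * (q ^ Suc m - e)"
      by (simp only: mult_ac)
    then have "q ^ m * (sym_count (2 * Suc m) d * (q - 1)) = q ^ m * (q ^ ((Suc m)\<^sup>2) * (q ^ Suc m + e) * P (Suc m))"
      using ne by (subst (asm) mult_right_cancel) auto
    then have "sym_count (2 * Suc m) d * (q - 1) = q ^ ((Suc m)\<^sup>2) * (q ^ Suc m + e) * P (Suc m)"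
      using q1 by (subst (asm) mult_left_cancel) auto
    then show ?thesis using q1 unfolding e_def by (simp add: eq_divide_eq)
  qed
  have card_nz: "real (card (UNIV - {0::'a})) = q - 1"
    by (simp add: card_Diff_singleton of_nat_diff q_def)
  have odd_total: "real (card (invertible_sym_mats (2 * m + 1) :: 'a mat set)) = q ^ (m\<^sup>2 + m) * P (Suc m)"
    if "real (card (invertible_sym_mats (2 * m) :: 'a mat set)) = q ^ (m\<^sup>2 + m) * P m" for m
  proof -
    have "(\<Sum>d\<in>UNIV - {0::'a}. sym_count (2 * m + 1) d) = (\<Sum>d\<in>UNIV - {0::'a}. q ^ (m\<^sup>2 + m) * P (Suc m) / (q - 1))"
      using odd[OF that] by (intro sum.cong) auto
    then show ?thesis using q1 unfolding sum_sym_count by (simp add: card_nz q_def[symmetric])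
  qed
  show total: "real (card (invertible_sym_mats (2 * m) :: 'a mat set)) = q ^ (m\<^sup>2 + m) * P m" for m
  proof (induction m)
    case 0
    show ?case by (simp add: invertible_sym_mats_0 P_def)
  next
    case (Suc m)
    let ?C = "q ^ ((Suc m)\<^sup>2) * P (Suc m) / (q - 1)"
    have "(\<Sum>d\<in>UNIV - {0::'a}. quad_char ((- 1) ^ Suc m * d)) = quad_char ((- 1 :: 'a) ^ Suc m) * (\<Sum>d\<in>UNIV - {0::'a}. quad_char d)"
      by (simp only: quad_char_mult[OF two] sum_distrib_left)
    also have "\<dots> = 0" by (simp add: sum_diff1 sum_quad_char[OF two])
    finally have "(\<Sum>d\<in>UNIV - {0::'a}. ?C * (q ^ Suc m + quad_char ((- 1) ^ Suc m * d))) = (q - 1) * ?C * q ^ Suc m"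
      unfolding sum_distrib_left[symmetric] sum.distrib sum_constant card_nz
      by (simp only: add_0_right mult_ac)
    moreover have "(\<Sum>d\<in>UNIV - {0::'a}. sym_count (2 * Suc m) d) = (\<Sum>d\<in>UNIV - {0::'a}. ?C * (q ^ Suc m + quad_char ((- 1) ^ Suc m * d)))"
      using even[OF odd_total[OF Suc]] by (intro sum.cong) (auto simp: mult_ac)
    ultimately have "real (card (invertible_sym_mats (2 * Suc m) :: 'a mat set)) = (q - 1) * ?C * q ^ Suc m"
      unfolding sum_sym_count by simp
    then show ?case using q1 by (simp add: power_add mult_ac)
  qed
  show "sym_count (2 * m + 1) d = q ^ (m\<^sup>2 + m) * P (Suc m) / (q - 1)"
    using odd total assms(2) by blast
  show "sym_count (2 * Suc m) d =
      q ^ ((Suc m)\<^sup>2) * (q ^ Suc m + quad_char ((- 1) ^ Suc m * d)) * P (Suc m) / (q - 1)"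
    using even odd_total total assms(2) by blast
qed

section \<open>The recursion for the deviation\<close>

lemma mat_trace_add_sym_outer:
  fixes T :: "'a::comm_ring_1 mat"
  assumes C: "C \<in> carrier_mat n n" and T: "T \<in> carrier_mat n n" "transpose_mat T = T"
    and b: "b \<in> carrier_vec n" and c: "c \<in> carrier_vec n"
  shows "mat_trace (mat n n (\<lambda>(i, j). C $$ (i, j) + c $ i * b $ j + b $ i * c $ j) * T) =
    mat_trace (C * T) + 2 * (c \<bullet> (T *\<^sub>v b))"
proof -
  have sym: "T $$ (j, i) = T $$ (i, j)" if "i < n" "j < n" for i j
    using T that by (metis carrier_matD index_transpose_mat(1))
  have bilinear: "c \<bullet> (T *\<^sub>v b) = (\<Sum>i<n. \<Sum>j<n. c $ i * T $$ (i, j) * b $ j)"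
    using T b c by (auto simp: scalar_prod_def lessThan_atLeast0 sum_distrib_left mult_ac intro!: sum.cong)
  have "(\<Sum>i<n. \<Sum>j<n. b $ i * c $ j * T $$ (j, i)) = (\<Sum>j<n. \<Sum>i<n. b $ i * c $ j * T $$ (j, i))"
    by (rule sum.swap)
  then have swapped: "(\<Sum>i<n. \<Sum>j<n. b $ i * c $ j * T $$ (j, i)) = c \<bullet> (T *\<^sub>v b)"
    by (simp only: bilinear mult_ac)
  have straight: "(\<Sum>i<n. \<Sum>j<n. c $ i * b $ j * T $$ (j, i)) = c \<bullet> (T *\<^sub>v b)"
    unfolding bilinear by (intro sum.cong refl) (simp add: sym mult_ac)
  have "mat_trace (mat n n (\<lambda>(i, j). C $$ (i, j) + c $ i * b $ j + b $ i * c $ j) * T) =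
      (\<Sum>i<n. \<Sum>j<n. C $$ (i, j) * T $$ (j, i) + c $ i * b $ j * T $$ (j, i) + b $ i * c $ j * T $$ (j, i))"
    using C T by (simp add: mat_trace_mult[of _ n]) (auto simp: distrib_right intro!: sum.cong)
  also have "\<dots> = mat_trace (C * T) + 2 * (c \<bullet> (T *\<^sub>v b))"
    unfolding sum.distrib straight swapped mat_trace_mult[OF C T(1)] by (simp only: mult_2 add.assoc)
  finally show ?thesis .
qed

lemma dual_vector_exists:
  fixes T :: "'a::field mat"
  assumes two: "(2::'a) \<noteq> 0" and T: "T \<in> invertible_sym_mats n"
    and b: "b \<in> carrier_vec n" "b \<noteq> 0\<^sub>v n"
  shows "\<exists>c\<in>carrier_vec n. 2 * (c \<bullet> (T *\<^sub>v b)) = 1"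
proof -
  note T' = invertible_sym_matsD[OF T]
  have Tb: "T *\<^sub>v b \<in> carrier_vec n" using T' b by simp
  have "T *\<^sub>v b \<noteq> 0\<^sub>v n"
    using det_0_iff_vec_prod_zero_field[OF T'(1)] T'(3) b by blast
  then obtain j where j: "j < n" "(T *\<^sub>v b) $ j \<noteq> 0"
    using Tb by (metis carrier_vecD eq_vecI index_zero_vec)
  define x where "x = (T *\<^sub>v b) $ j"
  have "((1 / (2 * x)) \<cdot>\<^sub>v unit_vec n j) \<bullet> (T *\<^sub>v b) = 1 / (2 * x) * x"
    using scalar_prod_left_unit[OF Tb j(1)] smult_scalar_prod_distrib[OF unit_vec_carrier Tb, of "1 / (2 * x)" j]
    by (simp only: x_def)
  moreover have "2 * (1 / (2 * x) * x) = 1" using j two by (simp add: x_def[symmetric])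
  ultimately have "2 * (((1 / (2 * x)) \<cdot>\<^sub>v unit_vec n j) \<bullet> (T *\<^sub>v b)) = 1" by (simp only:)
  then show ?thesis by (intro bexI) auto
qed

lemma sym_zero_corner_eq_border:
  fixes A :: "'a::field mat"
  assumes A: "A \<in> invertible_sym_mats (Suc n)" "A $$ (0, 0) = 0"
  obtains b C where "b \<in> carrier_vec n" "b \<noteq> 0\<^sub>v n" "C \<in> carrier_mat n n" "transpose_mat C = C" "A = border 0 b C"
proof -
  obtain b C where bC: "b \<in> carrier_vec n" "C \<in> carrier_mat n n" "transpose_mat C = C" "A = border 0 b C"
    using sym_eq_border[of A n] A by (auto simp: invertible_sym_mats_iff)
  have "b \<noteq> 0\<^sub>v n"
    using invertible_sym_matsD(3)[OF A(1)] det_border_zero[OF bC(2), of 0] bC(4) by auto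
  with bC show ?thesis using that by blast
qed

text \<open>The first row \<open>b\<close> of such a matrix is nonzero apart from the corner, so there is a vector \<open>c\<close>,
  depending on \<open>b\<close> only, for which the shear along \<open>(s' - s) c\<close> raises the trace by \<open>s' - s\<close>.
  The shear keeps \<open>b\<close>, hence it can be undone, and the map is injective.\<close>

lemma zero_corner_trace_equidistributed:
  fixes T :: "'a::{field,finite} mat" and d t :: 'a
  assumes two: "(2::'a) \<noteq> 0" and T: "T \<in> invertible_sym_mats n"
  defines "Z \<equiv> \<lambda>s. {A \<in> invertible_sym_mats (Suc n). A $$ (0, 0) = 0 \<and> det A = d \<and>
    mat_trace (A * border t (0\<^sub>v n) T) = s}"
  shows "card (Z s) = card (Z s')"
proof -
  note T' = invertible_sym_matsD[OF T]
  have "card (Z s) \<le> card (Z s')" for s s'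
  proof -
    obtain c where c: "c b \<in> carrier_vec n" "2 * (c b \<bullet> (T *\<^sub>v b)) = 1"
      if "b \<in> carrier_vec n" "b \<noteq> 0\<^sub>v n" for b
      using dual_vector_exists[OF two T] by metis
    \<comment> \<open>The shift is applied to a vector chosen once for each first row, so that the shear can be recovered from its result.\<close>
    define e where "e b = (s' - s) \<cdot>\<^sub>v c b" for b
    have e: "e b \<in> carrier_vec n" "2 * (e b \<bullet> (T *\<^sub>v b)) = s' - s" if "b \<in> carrier_vec n" "b \<noteq> 0\<^sub>v n" for b
    proof -
      show "e b \<in> carrier_vec n" using c(1)[OF that] by (simp add: e_def)
      have "(e b) \<bullet> (T *\<^sub>v b) = (s' - s) * (c b \<bullet> (T *\<^sub>v b))"
        unfolding e_def by (rule smult_scalar_prod_distrib[OF c(1)[OF that]]) (use T' that in simp)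
      then have "2 * (e b \<bullet> (T *\<^sub>v b)) = (s' - s) * (2 * (c b \<bullet> (T *\<^sub>v b)))"
        by (simp only: mult.left_commute)
      then show "2 * (e b \<bullet> (T *\<^sub>v b)) = s' - s" using c(2)[OF that] by simp
    qed
    define first_row where "first_row A = vec n (\<lambda>i. A $$ (0, Suc i))" for A :: "'a mat"
    have first_row: "first_row (border 0 b C) = b" if "b \<in> carrier_vec n" for b C
      using that by (auto simp: first_row_def)
    define D where "D b C = mat n n (\<lambda>(i, j). C $$ (i, j) + e b $ i * b $ j + b $ i * e b $ j)" for b and C :: "'a mat"
    define f where "f A = shear (e (first_row A)) * A * transpose_mat (shear (e (first_row A)))" for A
    have f: "f (border 0 b C) = border 0 b (D b C)" if "b \<in> carrier_vec n" "b \<noteq> 0\<^sub>v n" for b C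
    proof -
      have "b + 0 \<cdot>\<^sub>v e b = b" using that(1) e(1)[OF that] by (intro eq_vecI) auto
      then show ?thesis
        unfolding f_def first_row[OF that(1)] shear_congruence_border[OF e(1)[OF that] that(1)]
        by (simp add: D_def)
    qed
    have Z_border: "\<exists>b C. b \<in> carrier_vec n \<and> b \<noteq> 0\<^sub>v n \<and> C \<in> carrier_mat n n \<and> A = border 0 b C"
      if "A \<in> Z s" for A
    proof -
      from that have "A \<in> invertible_sym_mats (Suc n)" "A $$ (0, 0) = 0" by (simp_all add: Z_def)
      then show ?thesis by (rule sym_zero_corner_eq_border) blast
    qed
    show ?thesis
    proof (rule card_inj_on_le[of f])
      show "inj_on f (Z s)"
      proof (rule inj_onI)
        fix A A' assume A: "A \<in> Z s" "A' \<in> Z s" and eq: "f A = f A'"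
        obtain b C where bC: "b \<in> carrier_vec n" "b \<noteq> 0\<^sub>v n" "C \<in> carrier_mat n n" "A = border 0 b C"
          using Z_border[OF A(1)] by blast
        obtain b' C' where bC': "b' \<in> carrier_vec n" "b' \<noteq> 0\<^sub>v n" "C' \<in> carrier_mat n n" "A' = border 0 b' C'"
          using Z_border[OF A(2)] by blast
        from eq have "b = b'" "D b C = D b C'"
          using bC bC' by (auto simp: f border_inject[of _ n] D_def)
        moreover have "C = C'"
        proof (rule eq_matI)
          fix i j assume "i < dim_row C'" "j < dim_col C'"
          then have ij: "i < n" "j < n" using bC' by auto
          from \<open>D b C = D b C'\<close> have "D b C $$ (i, j) = D b C' $$ (i, j)" by simp
          then show "C $$ (i, j) = C' $$ (i, j)" using ij by (simp add: D_def)
        qed (use bC bC' in auto)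
        ultimately show "A = A'" by (simp add: bC bC')
      qed
      show "f ` Z s \<subseteq> Z s'"
      proof (rule image_subsetI)
        fix A assume A: "A \<in> Z s"
        then have sym: "A \<in> invertible_sym_mats (Suc n)" by (simp add: Z_def)
        obtain b C where bC: "b \<in> carrier_vec n" "b \<noteq> 0\<^sub>v n" "C \<in> carrier_mat n n" "A = border 0 b C"
          using Z_border[OF A] by blast
        let ?h = "transpose_mat (shear (e (first_row A)))"
        have h: "?h \<in> carrier_mat (Suc n) (Suc n)" "det ?h = 1"
          using e(1)[OF bC(1,2)] bC by (simp_all add: first_row det_transpose[of _ "Suc n"])
        have "f A \<in> invertible_sym_mats (Suc n)" "det (f A) = d"
          using congruence_invertible_sym[OF sym h(1)] h(2) A by (auto simp: f_def Z_def)
        moreover have "f A $$ (0, 0) = 0" using bC by (simp add: f)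
        moreover have "mat_trace (f A * border t (0\<^sub>v n) T) = s'"
        proof -
          have "mat_trace (f A * border t (0\<^sub>v n) T) = mat_trace (D b C * T)"
            using bC T' mat_trace_border[of b n "D b C" T 0 t] by (simp add: f D_def)
          also have "\<dots> = mat_trace (C * T) + (s' - s)"
            unfolding D_def mat_trace_add_sym_outer[OF bC(3) T'(1,2) bC(1) e(1)[OF bC(1,2)]] e(2)[OF bC(1,2)] ..
          also have "mat_trace (C * T) = s"
            using A mat_trace_border[OF bC(1,3) T'(1), of 0 t] bC(4) by (simp add: Z_def)
          finally show ?thesis by simp
        qed
        ultimately show "f A \<in> Z s'" by (simp add: Z_def)
      qed
      show "finite (Z s')" by (simp add: Z_def)
    qed
  qed
  then show ?thesis by (meson antisym)
qed

text \<open>The term \<open>z\<close> counts the matrices with zero corner entry. It is independent of the trace \<open>s\<close>, and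
  summing over \<open>s\<close> shows that it contributes equally to both terms of the deviation.\<close>

lemma trace_dev_border:
  fixes T :: "'a::{field,finite} mat"
  assumes two: "(2::'a) \<noteq> 0" and T: "T \<in> invertible_sym_mats n"
  shows "trace_dev (Suc n) (border t (0\<^sub>v n) T) d s =
    (\<Sum>a\<in>UNIV - {0}. \<Sum>b\<in>carrier_vec n. trace_dev n T (d / a) (s - a * t - quad_form T b / a))"
proof -
  let ?q = "real CARD('a)" and ?T = "border t (0\<^sub>v n) T"
  let ?V = "carrier_vec n :: 'a vec set"
  note T' = invertible_sym_matsD[OF T]
  define z where "z s = real (card {A \<in> invertible_sym_mats (Suc n). A $$ (0, 0) = 0 \<and> det A = d \<and>
    mat_trace (A * ?T) = s})" for s
  have z: "z s = z 0" for s
    unfolding z_def by (rule arg_cong[of _ _ real], rule zero_corner_trace_equidistributed[OF two T])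
  have count: "trace_count (Suc n) ?T d s =
      (\<Sum>a\<in>UNIV - {0}. \<Sum>b\<in>?V. trace_count n T (d / a) (s - a * t - quad_form T b / a)) + z 0" for s
  proof -
    let ?F = "\<lambda>A. of_bool (det A = d) * of_bool (mat_trace (A * ?T) = s) :: real"
    have "trace_count (Suc n) ?T d s = (\<Sum>A | A \<in> invertible_sym_mats (Suc n) \<and> A $$ (0, 0) \<noteq> 0. ?F A) +
        (\<Sum>A | A \<in> invertible_sym_mats (Suc n) \<and> A $$ (0, 0) = 0. ?F A)"
    proof -
      have split: "invertible_sym_mats (Suc n) = {A :: 'a mat. A \<in> invertible_sym_mats (Suc n) \<and> A $$ (0, 0) \<noteq> 0} \<union>
          {A. A \<in> invertible_sym_mats (Suc n) \<and> A $$ (0, 0) = 0}" (is "_ = ?N \<union> ?Z") by blast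
      have "sum ?F (?N \<union> ?Z) = sum ?F ?N + sum ?F ?Z" by (rule sum.union_disjoint) auto
      then show ?thesis by (simp only: trace_count_eq_sum split[symmetric])
    qed
    also have "(\<Sum>A | A \<in> invertible_sym_mats (Suc n) \<and> A $$ (0, 0) = 0. ?F A) = z s"
    proof -
      let ?Z = "{A :: 'a mat. A \<in> invertible_sym_mats (Suc n) \<and> A $$ (0, 0) = 0}"
      have "finite ?Z" by simp
      from real_card_eq_sum[OF this, of "\<lambda>A. det A = d \<and> mat_trace (A * ?T) = s"]
      have "(\<Sum>A\<in>?Z. ?F A) = real (card {A\<in>?Z. det A = d \<and> mat_trace (A * ?T) = s})"
        by (simp only: of_bool_conj)
      also have "{A\<in>?Z. det A = d \<and> mat_trace (A * ?T) = s} =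
          {A \<in> invertible_sym_mats (Suc n). A $$ (0, 0) = 0 \<and> det A = d \<and> mat_trace (A * ?T) = s}" by blast
      finally show ?thesis unfolding z_def .
    qed
    also have "(\<Sum>A | A \<in> invertible_sym_mats (Suc n) \<and> A $$ (0, 0) \<noteq> 0. ?F A) =
        (\<Sum>a\<in>UNIV - {0}. \<Sum>b\<in>?V. trace_count n T (d / a) (s - a * t - quad_form T b / a))"
      unfolding sum_invertible_sym_schur trace_count_eq_sum
    proof (intro sum.cong refl)
      fix a :: 'a and b :: "'a vec" and S :: "'a mat"
      assume *: "a \<in> UNIV - {0}" "b \<in> carrier_vec n" "S \<in> invertible_sym_mats n"
      note S = invertible_sym_matsD(1)[OF *(3)]
      have "det (border a b (add_outer (1 / a) b S)) = d \<longleftrightarrow> det S = d / a"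
        using * S by (auto simp: det_border_add_outer[of _ _ n] field_simps)
      moreover have "mat_trace (border a b (add_outer (1 / a) b S) * ?T) =
          a * t + (mat_trace (S * T) + 1 / a * quad_form T b)"
        using * S T' by (simp only: mat_trace_border[of _ n] add_outer_carrier mat_trace_add_outer[of _ n])
      then have "mat_trace (border a b (add_outer (1 / a) b S) * ?T) = s \<longleftrightarrow>
          mat_trace (S * T) = s - a * t - quad_form T b / a"
        by (auto simp: algebra_simps)
      ultimately show "?F (border a b (add_outer (1 / a) b S)) =
          of_bool (det S = d / a) * of_bool (mat_trace (S * T) = s - a * t - quad_form T b / a)"
        by simp
    qed
    finally show ?thesis by (simp only: z[of s])
  qed
  \<comment> \<open>The sum over all traces recovers the number of matrices of given determinant.\<close>
  have shift: "(\<Sum>s\<in>UNIV. trace_count n T d' (s - u - v)) = sym_count n d'" for d' u v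
  proof -
    have "(\<Sum>s\<in>UNIV. trace_count n T d' (s - u - v)) = (\<Sum>s\<in>UNIV. trace_count n T d' s)"
      by (rule sum.reindex_bij_witness[of _ "\<lambda>s. s + u + v" "\<lambda>s. s - u - v"]) (auto simp: algebra_simps)
    then show ?thesis by (simp only: sum_trace_count)
  qed
  have "sym_count (Suc n) d = (\<Sum>s\<in>UNIV. trace_count (Suc n) ?T d s)" by (rule sum_trace_count[symmetric])
  also have "\<dots> = (\<Sum>s\<in>UNIV. \<Sum>a\<in>UNIV - {0}. \<Sum>b\<in>?V. trace_count n T (d / a) (s - a * t - quad_form T b / a)) + ?q * z 0"
    by (simp add: count sum.distrib)
  also have "(\<Sum>s\<in>UNIV. \<Sum>a\<in>UNIV - {0}. \<Sum>b\<in>?V. trace_count n T (d / a) (s - a * t - quad_form T b / a)) =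
      (\<Sum>a\<in>UNIV - {0}. \<Sum>b\<in>?V. sym_count n (d / a))"
    by (subst sum.swap, intro sum.cong refl, subst sum.swap) (simp only: shift)
  finally have "sym_count (Suc n) d / ?q = (\<Sum>a\<in>UNIV - {0}. \<Sum>b\<in>?V. sym_count n (d / a) / ?q) + z 0"
    by (simp add: add_divide_distrib sum_divide_distrib)
  then show ?thesis
    unfolding trace_dev_def by (simp only: count sum_subtractf)
qed

text \<open>The scaling \<open>x \<mapsto> a x\<close> removes the denominator \<open>a\<close> of the value of the form.\<close>

lemma trace_dev_border_quad_dev:
  fixes T :: "'a::{field,finite} mat"
  assumes two: "(2::'a) \<noteq> 0" and T: "T \<in> invertible_sym_mats n"
  shows "trace_dev (Suc n) (border t (0\<^sub>v n) T) d s =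
    (\<Sum>a\<in>UNIV - {0}. \<Sum>x\<in>UNIV. quad_dev n (det T) (a * x) * trace_dev n T (d / a) (s - a * t - x))"
  unfolding trace_dev_border[OF two T]
proof (intro sum.cong refl)
  fix a :: 'a assume "a \<in> UNIV - {0}"
  then have a: "a \<noteq> 0" by simp
  have reindex: "(\<Sum>x\<in>UNIV. f (x / a)) = (\<Sum>x\<in>UNIV. f x)" for f :: "'a \<Rightarrow> real"
    by (rule sum.reindex_bij_witness[of _ "\<lambda>x. a * x" "\<lambda>x. x / a"]) (use a in auto)
  have "(\<Sum>x\<in>UNIV. trace_dev n T (d / a) (s - a * t - x)) = (\<Sum>x\<in>UNIV. trace_dev n T (d / a) x)"
    by (rule sum.reindex_bij_witness[of _ "\<lambda>x. s - a * t - x" "\<lambda>x. s - a * t - x"]) auto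
  then have "(\<Sum>x\<in>UNIV. trace_dev n T (d / a) (s - a * t - x / a)) = 0"
    using reindex[of "\<lambda>x. trace_dev n T (d / a) (s - a * t - x)"] by (simp add: sum_trace_dev)
  from sum_quad_form[OF two T this]
  have "(\<Sum>b\<in>carrier_vec n. trace_dev n T (d / a) (s - a * t - quad_form T b / a)) =
      (\<Sum>x\<in>UNIV. quad_dev n (det T) x * trace_dev n T (d / a) (s - a * t - x / a))" .
  also have "\<dots> = (\<Sum>x\<in>UNIV. quad_dev n (det T) (a * (x / a)) * trace_dev n T (d / a) (s - a * t - x / a))"
    using a by simp
  also have "\<dots> = (\<Sum>x\<in>UNIV. quad_dev n (det T) (a * x) * trace_dev n T (d / a) (s - a * t - x))"
    by (rule reindex)
  finally show "(\<Sum>b\<in>carrier_vec n. trace_dev n T (d / a) (s - a * t - quad_form T b / a)) =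
      (\<Sum>x\<in>UNIV. quad_dev n (det T) (a * x) * trace_dev n T (d / a) (s - a * t - x))" .
qed

section \<open>Solving the recursion\<close>

definition nonzero_tuples :: "nat \<Rightarrow> (nat \<Rightarrow> 'a::zero) set" where
  "nonzero_tuples m = {1..m} \<rightarrow>\<^sub>E UNIV - {0}"

definition even_total :: "nat \<Rightarrow> 'a::{field,finite} \<Rightarrow> real" where
  "even_total m c = (\<Sum>y\<in>nonzero_tuples m. of_bool ((\<Prod>i=1..m. y i)\<^sup>2 = 4 ^ m * c))"

text \<open>With \<open>c = d det T\<close> these are the tuples in the formula for even size. A zero entry is impossible,
  since \<open>c \<noteq> 0\<close>.\<close>

definition even_tuples :: "nat \<Rightarrow> 'a::{field,finite} \<Rightarrow> 'a \<Rightarrow> real" where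
  "even_tuples m c t = (\<Sum>y\<in>nonzero_tuples m.
     of_bool ((\<Sum>i=1..m. y i) = t) * of_bool ((\<Prod>i=1..m. y i)\<^sup>2 = 4 ^ m * c))"

text \<open>The tuples in the formula for odd size, sorted by their entry \<open>a\<close> with index \<open>0\<close>, which occurs
  to the first power in the product.\<close>

definition odd_tuples :: "nat \<Rightarrow> 'a::{field,finite} \<Rightarrow> 'a \<Rightarrow> real" where
  "odd_tuples m c t = (\<Sum>a\<in>UNIV - {0}. even_tuples m (c / a) (t - a))"

lemma finite_nonzero_tuples [simp]: "finite (nonzero_tuples m :: (nat \<Rightarrow> 'a::{zero,finite}) set)"
  by (simp add: nonzero_tuples_def finite_PiE)

lemma card_nonzero_tuples:
  "real (card (nonzero_tuples m :: (nat \<Rightarrow> 'a::{zero,finite}) set)) = (real CARD('a) - 1) ^ m"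
  by (simp add: nonzero_tuples_def card_PiE card_Diff_singleton of_nat_diff)

lemma prod_nonzero_tuple:
  fixes y :: "nat \<Rightarrow> 'a::field"
  assumes "y \<in> nonzero_tuples m"
  shows "(\<Prod>i=1..m. y i) \<noteq> 0"
  using assms by (auto simp: nonzero_tuples_def)

lemma sum_nonzero_tuples_Suc:
  fixes f :: "(nat \<Rightarrow> 'a::{zero,finite}) \<Rightarrow> real"
  shows "(\<Sum>y\<in>nonzero_tuples (Suc m). f y) = (\<Sum>y\<in>nonzero_tuples m. \<Sum>a\<in>UNIV - {0}. f (y(Suc m := a)))"
proof -
  let ?h = "\<lambda>(a :: 'a, y). y(Suc m := a)" and ?D = "(UNIV - {0}) \<times> nonzero_tuples m"
  have "inj_on ?h ?D"
    using inj_combinator[of "Suc m" "{1..m}" "\<lambda>_. UNIV - {0 :: 'a}"] by (simp add: nonzero_tuples_def)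
  moreover have "?h ` ?D = nonzero_tuples (Suc m)"
    by (simp add: nonzero_tuples_def atLeastAtMostSuc_conv PiE_insert_eq)
  ultimately have "(\<Sum>y\<in>nonzero_tuples (Suc m). f y) = (\<Sum>p\<in>?D. f (?h p))"
    using sum.reindex[of ?h ?D f] by simp
  also have "\<dots> = (\<Sum>a\<in>UNIV - {0}. \<Sum>y\<in>nonzero_tuples m. f (y(Suc m := a)))"
    by (simp add: sum.cartesian_product case_prod_unfold)
  finally show ?thesis by (subst sum.swap)
qed

lemma extend_tuple:
  fixes a :: "'a::comm_semiring_1"
  shows "(\<Sum>i=1..Suc m. (y(Suc m := a)) i) = (\<Sum>i=1..m. y i) + a"
    and "(\<Prod>i=1..Suc m. (y(Suc m := a)) i) = (\<Prod>i=1..m. y i) * a"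
  by (simp_all add: atLeastAtMostSuc_conv add.commute mult.commute)

lemma four_power_eq: "(4::'a::comm_semiring_1) ^ m = (2 ^ m)\<^sup>2"
proof -
  have "(4::'a) ^ m = (2 * 2) ^ m" by simp
  then show ?thesis by (simp only: power_mult_distrib power2_eq_square)
qed

text \<open>The product condition determines the entry with index \<open>0\<close> from the other ones.\<close>

lemma odd_tuples_eq:
  fixes c t :: "'a::{field,finite}"
  assumes two: "(2::'a) \<noteq> 0" and c: "c \<noteq> 0"
  shows "odd_tuples m c t = (\<Sum>y\<in>nonzero_tuples m. of_bool ((\<Sum>i=1..m. y i) + 4 ^ m * c / (\<Prod>i=1..m. y i)\<^sup>2 = t))"
    and "(\<Sum>a\<in>UNIV - {0}. even_total m (c / a)) = (real CARD('a) - 1) ^ m"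
proof -
  have solve: "(p\<^sup>2 = 4 ^ m * (c / a)) \<longleftrightarrow> a = 4 ^ m * c / p\<^sup>2" if "p \<noteq> 0" "a \<noteq> 0" for p a :: 'a
    using that by (auto simp: field_simps)
  have nz: "4 ^ m * c / p\<^sup>2 \<noteq> 0" if "p \<noteq> 0" for p using that two c by (simp add: four_power_eq)
  have single: "(\<Sum>a\<in>UNIV - {0}. f a * of_bool ((\<Prod>i=1..m. y i)\<^sup>2 = 4 ^ m * (c / a))) =
      f (4 ^ m * c / (\<Prod>i=1..m. y i)\<^sup>2)" if "y \<in> nonzero_tuples m" for y and f :: "'a \<Rightarrow> real"
  proof -
    note p = prod_nonzero_tuple[OF that]
    have "(\<Sum>a\<in>UNIV - {0}. f a * of_bool ((\<Prod>i=1..m. y i)\<^sup>2 = 4 ^ m * (c / a))) =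
        (\<Sum>a\<in>UNIV - {0}. f a * of_bool (a = 4 ^ m * c / (\<Prod>i=1..m. y i)\<^sup>2))"
      by (intro sum.cong refl) (use solve[OF p] in simp)
    then show ?thesis using nz[OF p] by (simp only: mult_sum_of_bool_eq(1)[OF finite] Diff_iff UNIV_I singleton_iff simp_thms if_True)
  qed
  have "odd_tuples m c t = (\<Sum>y\<in>nonzero_tuples m. \<Sum>a\<in>UNIV - {0}.
      of_bool ((\<Sum>i=1..m. y i) = t - a) * of_bool ((\<Prod>i=1..m. y i)\<^sup>2 = 4 ^ m * (c / a)))"
    unfolding odd_tuples_def even_tuples_def by (rule sum.swap)
  also have "\<dots> = (\<Sum>y\<in>nonzero_tuples m. of_bool ((\<Sum>i=1..m. y i) = t - 4 ^ m * c / (\<Prod>i=1..m. y i)\<^sup>2))"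
    by (intro sum.cong refl single)
  finally show "odd_tuples m c t = (\<Sum>y\<in>nonzero_tuples m. of_bool ((\<Sum>i=1..m. y i) + 4 ^ m * c / (\<Prod>i=1..m. y i)\<^sup>2 = t))"
    by (simp only: eq_diff_eq)
  have "(\<Sum>a\<in>UNIV - {0}. even_total m (c / a)) = (\<Sum>y\<in>nonzero_tuples m. \<Sum>a\<in>UNIV - {0}.
      1 * of_bool ((\<Prod>i=1..m. y i)\<^sup>2 = 4 ^ m * (c / a)))"
    unfolding even_total_def mult_1 by (rule sum.swap)
  also have "\<dots> = (\<Sum>y\<in>(nonzero_tuples m :: (nat \<Rightarrow> 'a) set). 1)"
    by (intro sum.cong refl single)
  finally show "(\<Sum>a\<in>UNIV - {0}. even_total m (c / a)) = (real CARD('a) - 1) ^ m"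
    by (simp add: card_nonzero_tuples)
qed

text \<open>The sum condition determines the last entry from the other ones; without this condition, the
  last entry is a square root of \<open>4\<^bsup>m+1\<^esup> c / p\<^sup>2\<close>, where \<open>p\<close> is the product of the others.\<close>

lemma even_tuples_Suc:
  fixes c t :: "'a::{field,finite}"
  assumes two: "(2::'a) \<noteq> 0" and c: "c \<noteq> 0"
  shows "even_tuples (Suc m) c t =
      (\<Sum>y\<in>nonzero_tuples m. of_bool ((t - (\<Sum>i=1..m. y i))\<^sup>2 = 4 * (4 ^ m * c / (\<Prod>i=1..m. y i)\<^sup>2)))"
    and "even_total (Suc m) c = (real CARD('a) - 1) ^ m * (1 + quad_char c)"
proof -
  have scaled: "4 * (4 ^ m * c / p\<^sup>2) = (2 ^ Suc m / p)\<^sup>2 * c" for p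
    by (simp only: power_divide four_power_eq[symmetric]) simp
  have nz: "4 * (4 ^ m * c / p\<^sup>2) \<noteq> 0" if "p \<noteq> 0" for p
    unfolding scaled using that two c by simp
  have solve: "(p * a)\<^sup>2 = 4 ^ Suc m * c \<longleftrightarrow> a\<^sup>2 = 4 * (4 ^ m * c / p\<^sup>2)" if "p \<noteq> 0" for p a :: 'a
    using that by (auto simp: field_simps power_mult_distrib)
  have "even_tuples (Suc m) c t = (\<Sum>y\<in>nonzero_tuples m. \<Sum>a\<in>UNIV - {0}.
      of_bool (a = t - (\<Sum>i=1..m. y i)) * of_bool (a\<^sup>2 = 4 * (4 ^ m * c / (\<Prod>i=1..m. y i)\<^sup>2)))"
    unfolding even_tuples_def sum_nonzero_tuples_Suc extend_tuple
    by (intro sum.cong refl) (simp only: solve[OF prod_nonzero_tuple] eq_diff_eq add.commute)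
  also have "\<dots> = (\<Sum>y\<in>nonzero_tuples m. of_bool ((t - (\<Sum>i=1..m. y i))\<^sup>2 = 4 * (4 ^ m * c / (\<Prod>i=1..m. y i)\<^sup>2)))"
  proof (intro sum.cong refl)
    fix y :: "nat \<Rightarrow> 'a" assume "y \<in> nonzero_tuples m"
    then have "4 * (4 ^ m * c / (\<Prod>i=1..m. y i)\<^sup>2) \<noteq> 0" by (intro nz prod_nonzero_tuple)
    then show "(\<Sum>a\<in>UNIV - {0}. of_bool (a = t - (\<Sum>i=1..m. y i)) * of_bool (a\<^sup>2 = 4 * (4 ^ m * c / (\<Prod>i=1..m. y i)\<^sup>2))) =
      (of_bool ((t - (\<Sum>i=1..m. y i))\<^sup>2 = 4 * (4 ^ m * c / (\<Prod>i=1..m. y i)\<^sup>2)) :: real)"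
      by (subst mult_sum_of_bool_eq(2)) (auto simp del: mult_eq_0_iff)
  qed
  finally show "even_tuples (Suc m) c t =
      (\<Sum>y\<in>nonzero_tuples m. of_bool ((t - (\<Sum>i=1..m. y i))\<^sup>2 = 4 * (4 ^ m * c / (\<Prod>i=1..m. y i)\<^sup>2)))" .
  have "even_total (Suc m) c = (\<Sum>y\<in>nonzero_tuples m. \<Sum>a\<in>UNIV - {0}.
      of_bool (a\<^sup>2 = 4 * (4 ^ m * c / (\<Prod>i=1..m. y i)\<^sup>2)))"
    unfolding even_total_def sum_nonzero_tuples_Suc extend_tuple
    by (intro sum.cong refl) (simp only: solve[OF prod_nonzero_tuple])
  also have "\<dots> = (\<Sum>y\<in>(nonzero_tuples m :: (nat \<Rightarrow> 'a) set). 1 + quad_char c)"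
  proof (intro sum.cong refl)
    fix y :: "nat \<Rightarrow> 'a" assume y: "y \<in> nonzero_tuples m"
    let ?s = "4 * (4 ^ m * c / (\<Prod>i=1..m. y i)\<^sup>2)"
    have "?s \<noteq> 0" using y by (intro nz prod_nonzero_tuple)
    then have "(\<Sum>a\<in>UNIV - {0}. of_bool (a\<^sup>2 = ?s)) = (\<Sum>a\<in>UNIV. of_bool (a\<^sup>2 = ?s) :: real)"
      by (intro sum.mono_neutral_left) auto
    also have "\<dots> = real (card {a\<in>UNIV. a\<^sup>2 = ?s})" by (simp only: real_card_eq_sum[OF finite])
    also have "\<dots> = 1 + quad_char ?s" using card_square_roots[OF two, of ?s] by simp
    also have "\<dots> = 1 + quad_char c"
      unfolding scaled using two prod_nonzero_tuple[OF y] by (subst quad_char_square_mult[OF two]) auto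
    finally show "(\<Sum>a\<in>UNIV - {0}. of_bool (a\<^sup>2 = ?s)) = 1 + quad_char c" .
  qed
  finally show "even_total (Suc m) c = (real CARD('a) - 1) ^ m * (1 + quad_char c)"
    by (simp add: card_nonzero_tuples)
qed

text \<open>The claimed closed form of the deviation. The subtracted terms are the averages of the tuple counts
  over \<open>t\<close>.\<close>

definition dev_formula :: "nat \<Rightarrow> 'a::{field,finite} \<Rightarrow> 'a \<Rightarrow> 'a \<Rightarrow> real" where
  "dev_formula n D d t = (let m = n div 2; q = real CARD('a) in
     if even n then quad_char ((- 1) ^ m * D) * q ^ (m\<^sup>2) * (even_tuples m (d * D) t - even_total m (d * D) / q)
     else q ^ (m\<^sup>2 + m) * (odd_tuples m (d * D) t - (q - 1) ^ m / q))"

lemma dev_formula_even: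
  "dev_formula (2 * m) D (d :: 'a::{field,finite}) t = quad_char ((- 1) ^ m * D) * real CARD('a) ^ (m\<^sup>2) *
     (even_tuples m (d * D) t - even_total m (d * D) / real CARD('a))"
  by (simp add: dev_formula_def Let_def)

lemma dev_formula_odd:
  "dev_formula (2 * m + 1) D (d :: 'a::{field,finite}) t = real CARD('a) ^ (m\<^sup>2 + m) *
     (odd_tuples m (d * D) t - (real CARD('a) - 1) ^ m / real CARD('a))"
  by (simp add: dev_formula_def Let_def)

lemma sum_quad_char_jacobi:
  fixes c u :: "'a::{field,finite}"
  assumes two: "(2::'a) \<noteq> 0"
  shows "(\<Sum>x\<in>UNIV - {0}. quad_char x * quad_char (u - x - c / x)) =
    quad_char (- 1 :: 'a) * ((if u\<^sup>2 = 4 * c then real CARD('a) else 0) - 1 - quad_char c)"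
proof -
  have "(\<Sum>x\<in>UNIV - {0}. quad_char x * quad_char (u - x - c / x)) =
      (\<Sum>x\<in>UNIV - {0}. quad_char (- 1 :: 'a) * quad_char (x\<^sup>2 - u * x + c))"
  proof (intro sum.cong refl)
    fix x :: 'a assume "x \<in> UNIV - {0}"
    then have "x * (u - x - c / x) = - 1 * (x\<^sup>2 - u * x + c)"
      by (simp add: power2_eq_square algebra_simps)
    then show "quad_char x * quad_char (u - x - c / x) = quad_char (- 1 :: 'a) * quad_char (x\<^sup>2 - u * x + c)"
      by (simp only: quad_char_mult[OF two, symmetric])
  qed
  then show ?thesis by (simp only: sum_distrib_left[symmetric] sum_quad_char_quadratic[OF two])
qed

lemma sum_nonzero_rescale:
  fixes t :: "'a::{field,finite}" and f :: "'a \<Rightarrow> real"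
  assumes "t \<noteq> 0"
  shows "(\<Sum>a\<in>UNIV - {0}. f (a * t)) = (\<Sum>a\<in>UNIV - {0}. f a)"
  by (rule sum.reindex_bij_witness[of _ "\<lambda>x. x / t" "\<lambda>x. x * t"]) (use assms in auto)

text \<open>The representation numbers contribute the indicator of \<open>x = 0\<close> minus a constant, and the constant
  is killed because the deviation has sum \<open>0\<close>. The two signs \<open>?e\<close> cancel, and the substitution
  \<open>y\<^sub>0 = a t\<close> identifies the remaining sum with \<open>odd_tuples\<close>.\<close>

lemma dev_formula_border_even:
  fixes t D d s :: "'a::{field,finite}"
  assumes two: "(2::'a) \<noteq> 0" and nz: "t \<noteq> 0" "D \<noteq> 0" "d \<noteq> 0"
  shows "(\<Sum>a\<in>UNIV - {0}. \<Sum>x\<in>UNIV. quad_dev (2 * m) D (a * x) * dev_formula (2 * m) D (d / a) (s - a * t - x)) =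
    dev_formula (2 * m + 1) (t * D) d s"
proof -
  let ?q = "real CARD('a)" and ?e = "quad_char ((- 1) ^ m * D)"
  let ?Y = "\<lambda>a x. even_tuples m (d * D / a) (s - a * t - x) - even_total m (d * D / a) / ?q"
  have ee: "?e * ?e = 1" using nz by (intro quad_char_mult_self[OF two]) simp
  have sum_Y: "(\<Sum>x\<in>UNIV. ?Y a x) = 0" for a
  proof -
    have "(\<Sum>x\<in>UNIV. even_tuples m (d * D / a) (s - a * t - x)) = (\<Sum>x\<in>UNIV. even_tuples m (d * D / a) x)"
      by (rule sum.reindex_bij_witness[of _ "\<lambda>x. s - a * t - x" "\<lambda>x. s - a * t - x"]) auto
    also have "\<dots> = (\<Sum>y\<in>nonzero_tuples m. \<Sum>x\<in>UNIV. of_bool (x = (\<Sum>i=1..m. y i)) * of_bool ((\<Prod>i=1..m. y i)\<^sup>2 = 4 ^ m * (d * D / a)))"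
      unfolding even_tuples_def by (subst sum.swap) (simp only: eq_commute)
    also have "\<dots> = even_total m (d * D / a)"
      by (simp only: mult_sum_of_bool_eq(2)[OF finite] UNIV_I if_True even_total_def)
    finally show ?thesis by (simp add: sum_subtractf)
  qed
  have "(\<Sum>x\<in>UNIV. quad_dev (2 * m) D (a * x) * dev_formula (2 * m) D (d / a) (s - a * t - x)) =
      ?q ^ (m\<^sup>2 + m) * ?Y a 0" if a: "a \<noteq> 0" for a
  proof -
    have "(\<Sum>x\<in>UNIV. quad_dev (2 * m) D (a * x) * dev_formula (2 * m) D (d / a) (s - a * t - x)) =
       (\<Sum>x\<in>UNIV. (?q ^ m * ?e * (of_bool (x = 0) - 1 / ?q)) * (?e * ?q ^ (m\<^sup>2) * ?Y a x))"
      unfolding dev_formula_even using a by (intro sum.cong refl) (simp add: quad_dev_def)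
    also have "\<dots> = (\<Sum>x\<in>UNIV. ?q ^ (m\<^sup>2 + m) * (of_bool (x = 0) * ?Y a x - 1 / ?q * ?Y a x))"
    proof (intro sum.cong refl)
      fix x
      have "(?q ^ m * ?e * (of_bool (x = 0) - 1 / ?q)) * (?e * ?q ^ (m\<^sup>2) * ?Y a x) =
          (?e * ?e) * (?q ^ (m\<^sup>2) * ?q ^ m) * ((of_bool (x = 0) - 1 / ?q) * ?Y a x)"
        by (simp only: mult_ac)
      then show "(?q ^ m * ?e * (of_bool (x = 0) - 1 / ?q)) * (?e * ?q ^ (m\<^sup>2) * ?Y a x) =
          ?q ^ (m\<^sup>2 + m) * (of_bool (x = 0) * ?Y a x - 1 / ?q * ?Y a x)"
        by (simp only: ee mult_1 power_add left_diff_distrib)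
    qed
    also have "\<dots> = ?q ^ (m\<^sup>2 + m) * ((\<Sum>x\<in>UNIV. of_bool (x = 0) * ?Y a x) - 1 / ?q * (\<Sum>x\<in>UNIV. ?Y a x))"
      by (simp only: sum_distrib_left[symmetric] sum_subtractf)
    also have "\<dots> = ?q ^ (m\<^sup>2 + m) * ?Y a 0"
      by (simp only: mult_sum_of_bool_eq(2)[OF finite] UNIV_I if_True sum_Y mult_zero_right diff_zero)
    finally show ?thesis .
  qed
  then have "(\<Sum>a\<in>UNIV - {0}. \<Sum>x\<in>UNIV. quad_dev (2 * m) D (a * x) * dev_formula (2 * m) D (d / a) (s - a * t - x)) =
      (\<Sum>a\<in>UNIV - {0}. ?q ^ (m\<^sup>2 + m) * ?Y a 0)"
    by (intro sum.cong refl) simp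
  also have "\<dots> = ?q ^ (m\<^sup>2 + m) * ((\<Sum>a\<in>UNIV - {0}. even_tuples m (d * D / a) (s - a * t)) -
      (\<Sum>a\<in>UNIV - {0}. even_total m (d * D / a)) / ?q)"
    by (simp only: sum_distrib_left[symmetric] sum_subtractf sum_divide_distrib diff_zero)
  also have "(\<Sum>a\<in>UNIV - {0}. even_total m (d * D / a)) = (?q - 1) ^ m"
    using nz by (intro odd_tuples_eq(2)[OF two]) simp
  also have "(\<Sum>a\<in>UNIV - {0}. even_tuples m (d * D / a) (s - a * t)) = odd_tuples m (d * (t * D)) s"
    unfolding odd_tuples_def
    using nz by (subst sum_nonzero_rescale[OF nz(1), symmetric]) (simp add: mult_ac)
  finally show ?thesis unfolding dev_formula_odd .
qed

text \<open>The constant in the closed form is killed by the sum of the character. For each tuple \<open>y\<close>, the inner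
  sum over \<open>x\<close> has one term, and the sum over \<open>a\<close> becomes the Jacobi-type sum with
  \<open>u = s - \<Sum>y\<^sub>i\<close> and \<open>c = 4\<^sup>m d t D / (\<Prod>y\<^sub>i)\<^sup>2\<close>. The condition \<open>u\<^sup>2 = 4 c\<close> says that \<open>u\<close> extends \<open>y\<close>
  to a tuple counted by \<open>even_tuples (Suc m)\<close>.\<close>

lemma dev_formula_border_odd:
  fixes t D d s :: "'a::{field,finite}"
  assumes two: "(2::'a) \<noteq> 0" and nz: "t \<noteq> 0" "D \<noteq> 0" "d \<noteq> 0"
  shows "(\<Sum>a\<in>UNIV - {0}. \<Sum>x\<in>UNIV. quad_dev (2 * m + 1) D (a * x) * dev_formula (2 * m + 1) D (d / a) (s - a * t - x)) =
    dev_formula (2 * Suc m) (t * D) d s"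
proof -
  let ?q = "real CARD('a)" and ?e = "quad_char ((- 1) ^ m * D)" and ?C = "d * (t * D)"
  let ?W = "nonzero_tuples m :: (nat \<Rightarrow> 'a) set"
  define c where "c y = 4 ^ m * ?C / (\<Prod>i=1..m. y i)\<^sup>2" for y :: "nat \<Rightarrow> 'a"
  define u where "u y = s - (\<Sum>i=1..m. y i)" for y :: "nat \<Rightarrow> 'a"
  have inner: "(\<Sum>x\<in>UNIV. quad_dev (2 * m + 1) D (a * x) * dev_formula (2 * m + 1) D (d / a) (s - a * t - x)) =
      ?q ^ (m\<^sup>2 + 2 * m) * ?e * quad_char t * (\<Sum>y\<in>?W. quad_char (a * t) * quad_char (u y - a * t - c y / (a * t)))"
    if a: "a \<noteq> 0" for a
  proof -
    have exponent: "?q ^ m * ?q ^ (m\<^sup>2 + m) = ?q ^ (m\<^sup>2 + 2 * m)"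
      by (simp only: power_add[symmetric]) (simp add: mult_2 add_ac)
    let ?X = "\<lambda>x. odd_tuples m (d * D / a) (s - a * t - x)"
    \<comment> \<open>The summation variable becomes a * t below, which leaves behind the factor quad_char t.\<close>
    have quad_char_a: "quad_char a = quad_char t * quad_char (a * t)"
      using nz quad_char_mult_self[OF two nz(1)] by (simp add: quad_char_mult[OF two])
    have "(\<Sum>x\<in>UNIV. quad_char x * ?X x) = (\<Sum>x\<in>UNIV. \<Sum>y\<in>?W. quad_char x *
        of_bool (x = u y - a * t - c y / (a * t)))"
    proof (intro sum.cong refl)
      fix x
      have "d * D / a \<noteq> 0" using nz a by simp
      from odd_tuples_eq(1)[OF two this]
      have "?X x = (\<Sum>y\<in>?W. of_bool ((\<Sum>i=1..m. y i) + 4 ^ m * (d * D / a) / (\<Prod>i=1..m. y i)\<^sup>2 = s - a * t - x))" .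
      also have "\<dots> = (\<Sum>y\<in>?W. of_bool (x = u y - a * t - c y / (a * t)))"
      proof (intro sum.cong refl)
        fix y assume "y \<in> ?W"
        have "4 ^ m * (d * D / a) / (\<Prod>i=1..m. y i)\<^sup>2 = c y / (a * t)"
          using a nz by (simp add: c_def)
        then show "of_bool ((\<Sum>i=1..m. y i) + 4 ^ m * (d * D / a) / (\<Prod>i=1..m. y i)\<^sup>2 = s - a * t - x) =
          (of_bool (x = u y - a * t - c y / (a * t)) :: real)"
          by (auto simp: u_def algebra_simps)
      qed
      finally show "quad_char x * ?X x = (\<Sum>y\<in>?W. quad_char x * of_bool (x = u y - a * t - c y / (a * t)))"
        by (simp only: sum_distrib_left)
    qed
    also have "\<dots> = (\<Sum>y\<in>?W. quad_char (u y - a * t - c y / (a * t)))"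
      by (subst sum.swap) (simp only: mult_sum_of_bool_eq(1)[OF finite] UNIV_I if_True)
    finally have X: "(\<Sum>x\<in>UNIV. quad_char x * ?X x) = (\<Sum>y\<in>?W. quad_char (u y - a * t - c y / (a * t)))" .
    have "(\<Sum>x\<in>UNIV. quad_dev (2 * m + 1) D (a * x) * dev_formula (2 * m + 1) D (d / a) (s - a * t - x)) =
      (\<Sum>x\<in>UNIV. (?q ^ m * ?q ^ (m\<^sup>2 + m) * ?e * quad_char a) * (quad_char x * ?X x - quad_char x * ((?q - 1) ^ m / ?q)))"
      unfolding dev_formula_odd
      by (intro sum.cong refl) (simp add: quad_dev_def quad_char_mult[OF two] right_diff_distrib mult_ac)
    also have "\<dots> = (?q ^ m * ?q ^ (m\<^sup>2 + m) * ?e * quad_char a) *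
        ((\<Sum>x\<in>UNIV. quad_char x * ?X x) - (\<Sum>x\<in>UNIV. quad_char (x::'a)) * ((?q - 1) ^ m / ?q))"
      by (simp only: sum_distrib_left[symmetric] sum_subtractf sum_distrib_right)
    also have "\<dots> = ?q ^ (m\<^sup>2 + 2 * m) * ?e * quad_char t *
        (quad_char (a * t) * (\<Sum>y\<in>?W. quad_char (u y - a * t - c y / (a * t))))"
      unfolding X sum_quad_char[OF two] exponent quad_char_a by (simp only: mult_zero_left diff_zero mult_ac)
    finally show ?thesis by (simp only: sum_distrib_left)
  qed
  have quad_char_c: "quad_char (c y) = quad_char ?C" if "y \<in> ?W" for y
  proof -
    have "c y = (2 ^ m / (\<Prod>i=1..m. y i))\<^sup>2 * ?C"
      by (simp only: c_def power_divide four_power_eq) simp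
    moreover have "2 ^ m / (\<Prod>i=1..m. y i) \<noteq> 0" using two prod_nonzero_tuple[OF that] by simp
    ultimately show ?thesis using quad_char_square_mult[OF two] by metis
  qed
  have "(\<Sum>a\<in>UNIV - {0}. \<Sum>x\<in>UNIV. quad_dev (2 * m + 1) D (a * x) * dev_formula (2 * m + 1) D (d / a) (s - a * t - x)) =
      (\<Sum>a\<in>UNIV - {0}. ?q ^ (m\<^sup>2 + 2 * m) * ?e * quad_char t *
        (\<Sum>y\<in>?W. quad_char (a * t) * quad_char (u y - a * t - c y / (a * t))))"
    by (intro sum.cong refl inner) auto
  also have "\<dots> = ?q ^ (m\<^sup>2 + 2 * m) * ?e * quad_char t *
      (\<Sum>a\<in>UNIV - {0}. \<Sum>y\<in>?W. quad_char (a * t) * quad_char (u y - a * t - c y / (a * t)))"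
    by (rule sum_distrib_left[symmetric])
  also have "(\<Sum>a\<in>UNIV - {0}. \<Sum>y\<in>?W. quad_char (a * t) * quad_char (u y - a * t - c y / (a * t))) =
      (\<Sum>a\<in>UNIV - {0}. \<Sum>y\<in>?W. quad_char a * quad_char (u y - a - c y / a))"
    by (rule sum_nonzero_rescale[OF nz(1)])
  also have "(\<Sum>a\<in>UNIV - {0}. \<Sum>y\<in>?W. quad_char a * quad_char (u y - a - c y / a)) =
      (\<Sum>y\<in>?W. \<Sum>a\<in>UNIV - {0}. quad_char a * quad_char (u y - a - c y / a))"
    by (rule sum.swap)
  also have "\<dots> = (\<Sum>y\<in>?W. quad_char (- 1 :: 'a) * (?q * of_bool ((u y)\<^sup>2 = 4 * c y) - (1 + quad_char ?C)))"
    by (intro sum.cong refl) (simp only: sum_quad_char_jacobi[OF two] quad_char_c, simp add: diff_diff_eq)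
  also have "\<dots> = quad_char (- 1 :: 'a) * (?q * (\<Sum>y\<in>?W. of_bool ((u y)\<^sup>2 = 4 * c y)) - (?q - 1) ^ m * (1 + quad_char ?C))"
    by (simp only: sum_distrib_left[symmetric] sum_subtractf sum_constant card_nonzero_tuples)
  also have "(\<Sum>y\<in>?W. of_bool ((u y)\<^sup>2 = 4 * c y)) = even_tuples (Suc m) ?C s"
    using nz by (subst even_tuples_Suc(1)[OF two]) (simp_all add: u_def c_def)
  also have "(?q - 1) ^ m * (1 + quad_char ?C) = even_total (Suc m) ?C"
    using nz by (subst even_tuples_Suc(2)[OF two]) simp_all
  also have "?q ^ (m\<^sup>2 + 2 * m) * ?e * quad_char t *
      (quad_char (- 1 :: 'a) * (?q * even_tuples (Suc m) ?C s - even_total (Suc m) ?C)) =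
      (?e * quad_char t * quad_char (- 1 :: 'a)) * (?q ^ (m\<^sup>2 + 2 * m) * ?q) *
      (even_tuples (Suc m) ?C s - even_total (Suc m) ?C / ?q)"
    by (simp add: field_simps)
  also have "?e * quad_char t * quad_char (- 1 :: 'a) = quad_char ((- 1) ^ Suc m * (t * D))"
    by (simp only: quad_char_mult[OF two] power_Suc mult_ac)
  also have "?q ^ (m\<^sup>2 + 2 * m) * ?q = ?q ^ ((Suc m)\<^sup>2)"
    unfolding power_Suc2[symmetric] by (intro arg_cong[of _ _ "power ?q"]) (simp add: power2_eq_square)
  finally show ?thesis unfolding dev_formula_even .
qed

lemma trace_dev_eq:
  fixes T :: "'a::{field,finite} mat"
  assumes two: "(2::'a) \<noteq> 0" and T: "T \<in> invertible_sym_mats n" and "d \<noteq> 0"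
  shows "trace_dev n T d t = dev_formula n (det T) d t"
  using two T \<open>d \<noteq> 0\<close>
proof (induction n T arbitrary: d t rule: invertible_sym_mats_induct)
  case (zero T)
  have "nonzero_tuples 0 = {\<lambda>_. undefined :: 'a}" by (simp add: nonzero_tuples_def)
  then show ?case using zero
    by (simp add: trace_dev_def trace_count_eq_sum sym_count_eq_sum invertible_sym_mats_0 mat_trace_def dev_formula_def Let_def
        even_tuples_def even_total_def )
next
  case (border n a T)
  note D = invertible_sym_matsD(1,3)[OF border(2)]
  have "trace_dev (Suc n) (border a (0\<^sub>v n) T) d t =
      (\<Sum>b\<in>UNIV - {0}. \<Sum>x\<in>UNIV. quad_dev n (det T) (b * x) * dev_formula n (det T) (d / b) (t - b * a - x))"
    unfolding trace_dev_border_quad_dev[OF two border(2)]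
    by (intro sum.cong refl) (use border.IH border.prems in simp)
  also have "\<dots> = dev_formula (Suc n) (a * det T) d t"
  proof (cases "even n")
    case True
    then obtain m where n: "n = 2 * m" by (rule evenE)
    show ?thesis
      using dev_formula_border_even[OF two border(1) D(2) border.prems(1), of m t] by (simp add: n)
  next
    case False
    then obtain m where n: "n = 2 * m + 1" by (rule oddE)
    show ?thesis
      using dev_formula_border_odd[OF two border(1) D(2) border.prems(1), of m t] by (simp add: n)
  qed
  finally show ?case by (simp only: det_border_zero[OF D(1)])
next
  case (congruence n g T)
  have "dev_formula n (det T) ((det g)\<^sup>2 * d) t = dev_formula n ((det g)\<^sup>2 * det T) d t"
    using congruence(3) by (simp add: dev_formula_def Let_def quad_char_mult[OF two] mult_ac)
  then show ?case
    using congruence.IH[of "(det g)\<^sup>2 * d" t] congruence.prems congruence(3)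
    unfolding trace_dev_congruence[OF invertible_sym_matsD(1)[OF congruence(1)] congruence(2,3)]
      congruence_invertible_sym(2)[OF congruence(1-3)]
    by simp
qed

section \<open>Assembling the counts\<close>

lemma card_even_tuples:
  fixes d D t :: "'a::{field,finite}"
  assumes two: "(2::'a) \<noteq> 0" and nz: "d \<noteq> 0" "D \<noteq> 0"
  shows "real (card {y \<in> {1..m} \<rightarrow>\<^sub>E UNIV. (\<Sum>i=1..m. y i) = t \<and> (\<Prod>i=1..m. y i)\<^sup>2 / (4 ^ m * D) = d}) =
    even_tuples m (d * D) t"
proof -
  have four: "(4 :: 'a) ^ m \<noteq> 0" using two by (simp add: four_power_eq)
  then have solve: "p\<^sup>2 / (4 ^ m * D) = d \<longleftrightarrow> p\<^sup>2 = 4 ^ m * (d * D)" for p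
    using nz by (auto simp: field_simps)
  have "{y \<in> {1..m} \<rightarrow>\<^sub>E UNIV. (\<Sum>i=1..m. y i) = t \<and> (\<Prod>i=1..m. y i)\<^sup>2 / (4 ^ m * D) = d} =
      {y \<in> nonzero_tuples m. (\<Sum>i=1..m. y i) = t \<and> (\<Prod>i=1..m. y i)\<^sup>2 = 4 ^ m * (d * D)}"
  proof -
    have "y i \<noteq> 0" if "(\<Prod>i=1..m. y i)\<^sup>2 = 4 ^ m * (d * D)" "i \<in> {1..m}" for y i
    proof -
      have "(\<Prod>i=1..m. y i)\<^sup>2 \<noteq> 0" unfolding that(1) using four nz by (simp only: mult_eq_0_iff simp_thms)
      then show ?thesis using that(2) by auto
    qed
    then show ?thesis unfolding solve by (auto simp: nonzero_tuples_def PiE_iff)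
  qed
  then show ?thesis
    by (simp only: even_tuples_def real_card_eq_sum[OF finite_nonzero_tuples] of_bool_conj)
qed

text \<open>A tuple indexed by \<open>{0..m}\<close> is a tuple indexed by \<open>{1..m}\<close> together with its entry at \<open>0\<close>.\<close>

lemma card_odd_tuples:
  fixes d D t :: "'a::{field,finite}"
  assumes two: "(2::'a) \<noteq> 0" and nz: "d \<noteq> 0" "D \<noteq> 0"
  shows "real (card {y \<in> {0..m} \<rightarrow>\<^sub>E UNIV. (\<Sum>i=0..m. y i) = t \<and>
      y 0 * (\<Prod>i=1..m. y i)\<^sup>2 / (4 ^ m * D) = d}) = odd_tuples m (d * D) t"
proof -
  let ?h = "\<lambda>(a :: 'a, y). y(0 := a)" and ?D = "(UNIV - {0 :: 'a}) \<times> nonzero_tuples m"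
  let ?P = "\<lambda>y. (\<Sum>i=0..m. y i) = t \<and> y 0 * (\<Prod>i=1..m. y i)\<^sup>2 / (4 ^ m * D) = d"
  have four: "(4 :: 'a) ^ m \<noteq> 0" using two by (simp add: four_power_eq)
  have index: "{0..m} = insert 0 {1..m}" by auto
  have inj: "inj_on ?h ?D"
    using inj_combinator[of 0 "{1..m}" "\<lambda>_. UNIV - {0 :: 'a}"] by (simp add: nonzero_tuples_def)
  have image: "?h ` ?D = {0..m} \<rightarrow>\<^sub>E UNIV - {0}"
    unfolding index PiE_insert_eq nonzero_tuples_def ..
  have P: "?P (y(0 := a)) \<longleftrightarrow> (\<Sum>i=1..m. y i) = t - a \<and> (\<Prod>i=1..m. y i)\<^sup>2 = 4 ^ m * (d * D / a)"
    if "a \<noteq> 0" for y a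
  proof -
    have "(\<Sum>i=0..m. (y(0 := a)) i) = a + (\<Sum>i=1..m. y i)"
      unfolding index by (subst sum.insert) auto
    moreover have "(\<Prod>i=1..m. (y(0 := a)) i) = (\<Prod>i=1..m. y i)"
      by (intro prod.cong) auto
    ultimately show ?thesis using four nz that by (auto simp: field_simps)
  qed
  have "{y \<in> {0..m} \<rightarrow>\<^sub>E UNIV. ?P y} = {y \<in> {0..m} \<rightarrow>\<^sub>E UNIV - {0}. ?P y}"
  proof -
    have "y i \<noteq> 0" if "?P y" "i \<le> m" for y i
      using that nz by (cases "i = 0") auto
    then show ?thesis by (auto simp: PiE_iff)
  qed
  then have "real (card {y \<in> {0..m} \<rightarrow>\<^sub>E UNIV. ?P y}) = (\<Sum>y\<in>?h ` ?D. of_bool (?P y))"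
    unfolding image by (simp only: real_card_eq_sum finite_PiE finite_atLeastAtMost finite)
  also have "\<dots> = (\<Sum>p\<in>?D. of_bool (?P (?h p)))"
    by (subst sum.reindex[OF inj]) (simp only: o_def)
  also have "\<dots> = (\<Sum>a\<in>UNIV - {0}. \<Sum>y\<in>nonzero_tuples m. of_bool (?P (y(0 := a))))"
    unfolding sum.cartesian_product by (intro sum.cong refl) auto
  also have "\<dots> = odd_tuples m (d * D) t"
    unfolding odd_tuples_def even_tuples_def
    by (intro sum.cong refl, unfold of_bool_conj[symmetric], rule arg_cong[of _ _ of_bool], rule P) auto
  finally show ?thesis .
qed

lemma trace_count_odd:
  fixes T :: "'a::{field,finite} mat"
  assumes two: "(2::'a) \<noteq> 0" and T: "T \<in> invertible_sym_mats (2 * m + 1)" and d: "d \<noteq> 0"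
  defines "q \<equiv> real CARD('a)"
  shows "trace_count (2 * m + 1) T d t =
    q ^ (m\<^sup>2 + m) / (q * (q - 1)) * ((\<Prod>k=0..m. q ^ (2 * k + 1) - 1) - (q - 1) ^ (m + 1)) +
    q ^ (m\<^sup>2 + m) * odd_tuples m (d * det T) t"
proof -
  have q: "q > 1" unfolding q_def by (rule one_less_card_field)
  have P: "(\<Prod>k=0..m. q ^ (2 * k + 1) - 1) = (\<Prod>k<Suc m. q ^ (2 * k + 1) - 1)"
    by (intro prod.cong) auto
  have "trace_count (2 * m + 1) T d t = dev_formula (2 * m + 1) (det T) d t + sym_count (2 * m + 1) d / q"
    using trace_dev_eq[OF two T d, of t] by (simp add: trace_dev_def q_def)
  also have "\<dots> = q ^ (m\<^sup>2 + m) * (odd_tuples m (d * det T) t - (q - 1) ^ m / q) +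
      q ^ (m\<^sup>2 + m) * (\<Prod>k<Suc m. q ^ (2 * k + 1) - 1) / (q - 1) / q"
    unfolding dev_formula_odd sym_count_closed_form(2)[OF two d] q_def[symmetric] ..
  also have "K * (X - w / q) + K * R / (q - 1) / q = K / (q * (q - 1)) * (R - (q - 1) * w) + K * X" for K X R w
    using q by (simp add: field_simps)
  finally show ?thesis by (simp only: P power_add[of "q - 1" m 1] power_one_right mult.commute[of "q - 1"])
qed

text \<open>For \<open>m > 0\<close> the number of tuples without sum condition is \<open>(q - 1)\<^bsup>m-1\<^esup> (1 + \<eta>(d det T))\<close>, which gives
  the term with \<open>\<eta>(d) + \<eta>(det T)\<close>. For \<open>m = 0\<close> there is no such expression, but then this
  number equals the number of matrices of determinant \<open>d\<close>, so that both cancel, as do the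
  corresponding terms of the formula.\<close>

lemma trace_count_even:
  fixes T :: "'a::{field,finite} mat"
  assumes two: "(2::'a) \<noteq> 0" and T: "T \<in> invertible_sym_mats (2 * m)" and d: "d \<noteq> 0"
  defines "q \<equiv> real CARD('a)" and "\<epsilon> \<equiv> quad_char (- 1 :: 'a) ^ m"
  shows "trace_count (2 * m) T d t =
    q ^ (m\<^sup>2) / (q * (q - 1)) * ((q ^ m + \<epsilon> * quad_char d) * (\<Prod>k<m. q ^ (2 * k + 1) - 1) -
      \<epsilon> * (quad_char d + quad_char (det T)) * (q - 1) ^ m) +
    quad_char ((- 1) ^ m * det T) * q ^ (m\<^sup>2) * even_tuples m (d * det T) t"
proof -
  note D = invertible_sym_matsD[OF T]
  have q: "q > 1" unfolding q_def by (rule one_less_card_field)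
  have count: "trace_count (2 * m) T d t = dev_formula (2 * m) (det T) d t + sym_count (2 * m) d / q"
    using trace_dev_eq[OF two T d, of t] by (simp add: trace_dev_def q_def)
  have eps: "quad_char ((- 1) ^ m * c) = \<epsilon> * quad_char c" for c :: 'a
    by (simp only: \<epsilon>_def quad_char_mult[OF two] quad_char_power[OF two])
  show ?thesis
  proof (cases m)
    case 0
    have D1: "det T = 1" using det_dim_zero[of T] D(1) 0 by simp
    have "nonzero_tuples 0 = {\<lambda>_. undefined :: 'a}" by (simp add: nonzero_tuples_def)
    then have "sym_count 0 d = even_total 0 d"
      by (simp add: sym_count_eq_sum even_total_def invertible_sym_mats_0)
    then show ?thesis
      using count by (simp add: 0 D1 \<epsilon>_def dev_formula_def Let_def q_def)
  next
    case (Suc l)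
    let ?P = "\<Prod>k<m. q ^ (2 * k + 1) - 1" and ?x = "quad_char d" and ?y = "quad_char (det T)"
    have yy: "?y * ?y = 1" using D by (intro quad_char_mult_self[OF two])
    have "trace_count (2 * m) T d t =
      \<epsilon> * ?y * q ^ (m\<^sup>2) * (even_tuples m (d * det T) t - (q - 1) ^ l * (1 + ?x * ?y) / q) +
      q ^ (m\<^sup>2) * (q ^ m + \<epsilon> * ?x) * ?P / (q - 1) / q"
    proof -
      have "even_total m (d * det T) = (q - 1) ^ l * (1 + ?x * ?y)"
        unfolding Suc q_def quad_char_mult[OF two, symmetric]
        using d D by (intro even_tuples_Suc(2)[OF two]) simp
      moreover have "sym_count (2 * m) d = q ^ (m\<^sup>2) * (q ^ m + quad_char ((- 1) ^ m * d)) * ?P / (q - 1)"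
        unfolding Suc q_def by (rule sym_count_closed_form(3)[OF two d])
      ultimately show ?thesis
        unfolding count dev_formula_even by (simp only: eps q_def[symmetric])
    qed
    also have "\<epsilon> * ?y * q ^ (m\<^sup>2) * (even_tuples m (d * det T) t - (q - 1) ^ l * (1 + ?x * ?y) / q) =
        \<epsilon> * ?y * q ^ (m\<^sup>2) * even_tuples m (d * det T) t - q ^ (m\<^sup>2) / q * (\<epsilon> * (?y + (?y * ?y) * ?x) * (q - 1) ^ l)"
      by (simp add: field_simps)
    also have "\<epsilon> * (?y + (?y * ?y) * ?x) * (q - 1) ^ l = \<epsilon> * (?x + ?y) * (q - 1) ^ m / (q - 1)"
      using q by (simp add: yy Suc)
    also have "Y - K / q * (w / (q - 1)) + K * u * R / (q - 1) / q = K / (q * (q - 1)) * (u * R - w) + Y" for Y K u w R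
      by (simp add: right_diff_distrib diff_divide_distrib mult_ac)
    finally show ?thesis unfolding eps .
  qed
qed

theorem corollary3p3p6:
  fixes T :: "'a::{field,finite} mat" and d t :: 'a and q n :: nat
  assumes "primepow q" and "odd q" and "CARD('a) = q"
    and "T \<in> invertible_sym_mats n"
    and "d \<noteq> 0"
  shows "(\<forall>m. n = 2 * m + 1 \<longrightarrow>
      real (card {A \<in> invertible_sym_mats n. det A = d \<and> mat_trace (A * T) = t}) =
        real q ^ (m\<^sup>2 + m) / (real q * (real q - 1)) *
          ((\<Prod>k=0..m. real q ^ (2 * k + 1) - 1) - (real q - 1) ^ (m + 1))
        + real q ^ (m\<^sup>2 + m) *
          real (card {y \<in> {0..m} \<rightarrow>\<^sub>E (UNIV :: 'a set).
            (\<Sum>i=0..m. y i) = t \<and>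
            y 0 * (\<Prod>i=1..m. y i)\<^sup>2 / (4 ^ m * det T) = d})) \<and>
    (\<forall>m \<chi>. n = 2 * m \<longrightarrow> nontrivial_quadratic_character \<chi> \<longrightarrow>
      complex_of_nat (card {A \<in> invertible_sym_mats n. det A = d \<and> mat_trace (A * T) = t}) =
        of_nat q ^ (m\<^sup>2) / (of_nat q * (of_nat q - 1)) *
          ((of_nat q ^ m + \<chi> (- 1) ^ m * \<chi> d) * (\<Prod>k<m. of_nat q ^ (2 * k + 1) - 1)
            - \<chi> (- 1) ^ m * (\<chi> d + \<chi> (det T)) * (of_nat q - 1) ^ m)
        + \<chi> ((- 1) ^ m * det T) * of_nat q ^ (m\<^sup>2) *
          of_nat (card {y \<in> {1..m} \<rightarrow>\<^sub>E (UNIV :: 'a set).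
            (\<Sum>i=1..m. y i) = t \<and>
            (\<Prod>i=1..m. y i)\<^sup>2 / (4 ^ m * det T) = d}))"
proof (intro conjI allI impI)
  have two: "(2::'a) \<noteq> 0" using assms(2,3) by (intro two_neq_0_if_odd_card) simp
  have D: "det T \<noteq> 0" using invertible_sym_matsD(3)[OF assms(4)] .
  {
    fix m assume n: "n = 2 * m + 1"
    have T: "T \<in> invertible_sym_mats (2 * m + 1)" using assms(4) n by simp
    show "real (card {A \<in> invertible_sym_mats n. det A = d \<and> mat_trace (A * T) = t}) =
        real q ^ (m\<^sup>2 + m) / (real q * (real q - 1)) *
          ((\<Prod>k=0..m. real q ^ (2 * k + 1) - 1) - (real q - 1) ^ (m + 1))
        + real q ^ (m\<^sup>2 + m) *
          real (card {y \<in> {0..m} \<rightarrow>\<^sub>E (UNIV :: 'a set).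
            (\<Sum>i=0..m. y i) = t \<and>
            y 0 * (\<Prod>i=1..m. y i)\<^sup>2 / (4 ^ m * det T) = d})"
      unfolding n card_odd_tuples[OF two assms(5) D] trace_count_def[symmetric] assms(3)[symmetric]
      by (rule trace_count_odd[OF two T assms(5)])
  next
    fix m and \<chi> :: "'a \<Rightarrow> complex"
    assume n: "n = 2 * m" and \<chi>: "nontrivial_quadratic_character \<chi>"
    have T: "T \<in> invertible_sym_mats (2 * m)" using assms(4) n by simp
    have \<chi>_eq: "\<chi> (- 1) = complex_of_real (quad_char (- 1 :: 'a))" "\<chi> d = complex_of_real (quad_char d)"
      "\<chi> (det T) = complex_of_real (quad_char (det T))"
      "\<chi> ((- 1) ^ m * det T) = complex_of_real (quad_char ((- 1) ^ m * det T))"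
      using D assms(5) by (intro nontrivial_quadratic_character_eq[OF two \<chi>]; simp)+
    have "complex_of_nat (card {A \<in> invertible_sym_mats n. det A = d \<and> mat_trace (A * T) = t}) =
        complex_of_real (trace_count (2 * m) T d t)"
      by (simp add: trace_count_def n)
    then show "complex_of_nat (card {A \<in> invertible_sym_mats n. det A = d \<and> mat_trace (A * T) = t}) =
        of_nat q ^ (m\<^sup>2) / (of_nat q * (of_nat q - 1)) *
          ((of_nat q ^ m + \<chi> (- 1) ^ m * \<chi> d) * (\<Prod>k<m. of_nat q ^ (2 * k + 1) - 1)
            - \<chi> (- 1) ^ m * (\<chi> d + \<chi> (det T)) * (of_nat q - 1) ^ m)
        + \<chi> ((- 1) ^ m * det T) * of_nat q ^ (m\<^sup>2) *
          of_nat (card {y \<in> {1..m} \<rightarrow>\<^sub>E (UNIV :: 'a set).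
            (\<Sum>i=1..m. y i) = t \<and>
            (\<Prod>i=1..m. y i)\<^sup>2 / (4 ^ m * det T) = d})"
      unfolding trace_count_even[OF two T assms(5)] card_even_tuples[OF two assms(5) D, symmetric] \<chi>_eq assms(3)
      by simp
  }
qed

end
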